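(* Let $U\subseteq R_{2,1}$ be a basepoint free four-dimensional subspace such that $I_U$ has a unique linear first syzygy of bidegree $(0,1)$, so that $I_U=\langle pu,pv,p_2,p_3\rangle$ with $p\in R_{2,0}$. Then there is a complex of bigraded free $R$-modules \[0\longrightarrow F_3\xrightarrow{\phi_3}F_2\xrightarrow{\phi_2}F_1\xrightarrow{\phi_1}I_U\longrightarrow 0,\] with $\phi_1=[p_0\ p_1\ p_2\ p_3]$, $F_1=R(-2,-1)^4$, $F_2=R(-2,-2)\oplus R(-3,-2)^2\oplus R(-4,-1)^2$, $F_3=R(-4,-2)^2$. Explicitly, after a linear change of the variables $s,t$ and a choice of basis $p_0,\dots,p_3$ of $U$ in the normal form of Case 1 (if $p$ is the square of a linear form) or Case 2 (if $p$ is a product of two linearly independent linear forms) described in the context, the maps $\phi_2,\phi_3$ are given by the matrices listed in the context for that case.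
   Context: $k$ is an algebraically closed field and $R=k[s,t,u,v]$ is bigraded with $s,t$ of degree $(1,0)$ and $u,v$ of degree $(0,1)$; $R_{m,n}$ is the graded piece of bidegree $(m,n)$. $U=\mathrm{Span}\{p_0,p_1,p_2,p_3\}\subseteq R_{2,1}$ is a four-dimensional subspace and $I_U=\langle p_0,p_1,p_2,p_3\rangle$. $U$ is basepoint free if the $p_i$ have no common zero on $\mathbb{P}^1\times\mathbb{P}^1$, i.e. $\sqrt{I_U}=\langle s,t\rangle\cap\langle u,v\rangle$. A first syzygy of bidegree $(a,b)$ is a nonzero $(g_i)\in R_{a,b}^4$ with $\sum g_ip_i=0$; "unique" means unique up to nonzero scalar. Normal forms. Let $l_i=a_iu+b_iv\in R_{0,1}$ ($i=1,\dots,4$), $q=l_1l_4-l_2l_3$, which is nonzero and factors as $q=L_1L_2$ with $L_i=\alpha_iu+\beta_iv$. Case 1 ($p=s^2$): $p_0=s^2u$, $p_1=s^2v$, $p_2=stl_1+t^2l_2$, $p_3=stl_3+t^2l_4$, and \[\phi_2=\begin{bmatrix} v&\alpha_1tL_2&0&a_1st+a_2t^2&a_3st+a_4t^2\\ -u&\beta_1tL_2&0&b_1st+b_2t^2&b_3st+b_4t^2\\ 0&-sl_4&sl_3+tl_4&-s^2&0\\ 0&sl_2&-sl_1-tl_2&0&-s^2\end{bmatrix},\quad \phi_3=\begin{bmatrix}\gamma&\delta\\ s&-t\\ 0&-s\\ -l_4&-l_3\\ l_2&l_1\end{bmatrix},\] $\gamma=-\alpha_1\beta_2st+(a_1st+a_2t^2)b_4-(a_3st+a_4t^2)b_2$,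 $\delta=\alpha_1\beta_2t^2+(a_1st+a_2t^2)b_3-(a_3st+a_4t^2)b_1$. Case 2 ($p=st$): $p_0=stu$, $p_1=stv$, $p_2=s^2l_1+t^2l_2$, $p_3=s^2l_3+t^2l_4$, and \[\phi_2=\begin{bmatrix} v&-\alpha_1tL_2&\alpha_1sL_2&a_1s^2+a_2t^2&a_3s^2+a_4t^2\\ -u&-\beta_1tL_2&\beta_1sL_2&b_1s^2+b_2t^2&b_3s^2+b_4t^2\\ 0&-sl_3&-tl_4&-st&0\\ 0&sl_1&tl_2&0&-st\end{bmatrix},\quad \phi_3=\begin{bmatrix}\gamma&\delta\\ 0&t\\ s&0\\ -l_4&-l_3\\ l_2&l_1\end{bmatrix},\] $\gamma=(-\alpha_1\beta_2+a_1b_4-a_3b_2)s^2+(a_2b_4-a_4b_2)t^2$, $\delta=(a_1b_3-a_3b_1)s^2+(\alpha_1\beta_2+a_2b_3-a_4b_1)t^2$. *)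

theory Defs
  imports
    "HOL-Library.Poly_Mapping"
    "HOL-Computational_Algebra.Polynomial"
    "Jordan_Normal_Form.Matrix"
begin

section \<open>The bigraded ring \<open>k[s,t,u,v]\<close>\<close>

datatype bivar = Vs | Vt | Vu | Vv

type_synonym 'k biring = "(bivar \<Rightarrow>\<^sub>0 nat) \<Rightarrow>\<^sub>0 'k"

definition const :: "'k \<Rightarrow> 'k::comm_ring_1 biring" where
  "const c = Poly_Mapping.single 0 c"

definition var :: "bivar \<Rightarrow> 'k::comm_ring_1 biring" where
  "var i = Poly_Mapping.single (Poly_Mapping.single i 1) 1"

text \<open>Bidegrees are integers so that twists can be formed; a piece of negative bidegree is \<open>{0}\<close>.\<close>

definition R_deg :: "int \<times> int \<Rightarrow> 'k::comm_ring_1 biring set" where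
  "R_deg d = {f. \<forall>m\<in>Poly_Mapping.keys f.
     int (Poly_Mapping.lookup m Vs + Poly_Mapping.lookup m Vt) = fst d \<and>
     int (Poly_Mapping.lookup m Vu + Poly_Mapping.lookup m Vv) = snd d}"

definition eval_at :: "(bivar \<Rightarrow> 'k) \<Rightarrow> 'k::comm_ring_1 biring \<Rightarrow> 'k" where
  "eval_at z f = (\<Sum>m\<in>Poly_Mapping.keys f. Poly_Mapping.lookup f m *
     (z Vs ^ Poly_Mapping.lookup m Vs * z Vt ^ Poly_Mapping.lookup m Vt *
      z Vu ^ Poly_Mapping.lookup m Vu * z Vv ^ Poly_Mapping.lookup m Vv))"

text \<open>Two linear structures on the ring: as a vector space over the constants (\<open>kvs\<close>) and as a
  module over itself, whose submodule spans are the generated ideals (\<open>Rmod\<close>).\<close>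

definition kscale :: "'k::comm_ring_1 \<Rightarrow> 'k biring \<Rightarrow> 'k biring" where
  "kscale c f = const c * f"

global_interpretation kvs: vector_space "kscale :: 'k::field \<Rightarrow> 'k biring \<Rightarrow> 'k biring"
  by unfold_locales
    (simp_all add: kscale_def const_def algebra_simps single_add mult_single)

global_interpretation Rmod: Modules.module "(*) :: 'r::comm_ring_1 \<Rightarrow> 'r \<Rightarrow> 'r"
  by unfold_locales (simp_all add: algebra_simps)

definition gen_ideal :: "'k::comm_ring_1 biring set \<Rightarrow> 'k biring set" where
  "gen_ideal B = Rmod.span B"

definition list_basis :: "'k::field biring set \<Rightarrow> 'k biring list \<Rightarrow> bool" where
  "list_basis W ps \<longleftrightarrow> distinct ps \<and> kvs.independent (set ps) \<and> kvs.span (set ps) = W"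

text \<open>\<open>(z Vs : z Vt)\<close> and \<open>(z Vu : z Vv)\<close> are homogeneous coordinates of a point of
  the product of two projective lines.\<close>

definition basepoint_free :: "'k::comm_ring_1 biring set \<Rightarrow> bool" where
  "basepoint_free W \<longleftrightarrow>
     (\<forall>z. (z Vs, z Vt) \<noteq> (0, 0) \<and> (z Vu, z Vv) \<noteq> (0, 0) \<longrightarrow> (\<exists>f\<in>W. eval_at z f \<noteq> 0))"

section \<open>Syzygies and complexes\<close>

definition is_syzygy :: "'k::comm_ring_1 biring list \<Rightarrow> int \<times> int \<Rightarrow> 'k biring vec \<Rightarrow> bool" where
  "is_syzygy ps d g \<longleftrightarrow> g \<in> carrier_vec (length ps) \<and> g \<noteq> 0\<^sub>v (length ps) \<and>
     (\<forall>i<length ps. g $ i \<in> R_deg d) \<and> (\<Sum>i<length ps. g $ i * ps ! i) = 0"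

definition unique_syzygy :: "'k::comm_ring_1 biring list \<Rightarrow> int \<times> int \<Rightarrow> bool" where
  "unique_syzygy ps d \<longleftrightarrow>
     (\<exists>g. is_syzygy ps d g \<and> (\<forall>h. is_syzygy ps d h \<longrightarrow> (\<exists>c. c \<noteq> 0 \<and> h = const c \<cdot>\<^sub>v g)))"

text \<open>A finite free bigraded module is given by the list of the bidegrees of its generators, so
  that \<open>R(-a,-b)\<close> contributes the entry \<open>(a,b)\<close>; its elements are vectors over the ring.\<close>

definition free_piece ::
    "(int \<times> int) list \<Rightarrow> int \<times> int \<Rightarrow> 'k::comm_ring_1 biring vec set" where
  "free_piece F d = {x \<in> carrier_vec (length F). \<forall>i<length F.
     x $ i \<in> R_deg (fst d - fst (F ! i), snd d - snd (F ! i))}"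

definition bigraded_map ::
    "(int \<times> int) list \<Rightarrow> (int \<times> int) list \<Rightarrow> 'k::comm_ring_1 biring mat \<Rightarrow> bool" where
  "bigraded_map F G A \<longleftrightarrow> A \<in> carrier_mat (length G) (length F) \<and>
     (\<forall>d. \<forall>x\<in>free_piece F d. A *\<^sub>v x \<in> free_piece G d)"

text \<open>\<open>0 \<rightarrow> F3 \<rightarrow> F2 \<rightarrow> F1 \<rightarrow> J \<rightarrow> 0\<close> is a complex of bigraded modules with maps of bidegree
  \<open>(0,0)\<close>, for an ideal \<open>J\<close> graded as a submodule of the ring itself; the two outer compositions
  vanish trivially. No exactness is required.\<close>

definition bigraded_complex ::
    "(int \<times> int) list \<Rightarrow> (int \<times> int) list \<Rightarrow> (int \<times> int) list \<Rightarrow> 'k::comm_ring_1 biring set \<Rightarrow>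
     'k biring mat \<Rightarrow> 'k biring mat \<Rightarrow> 'k biring mat \<Rightarrow> bool" where
  "bigraded_complex F3 F2 F1 J \<phi>3 \<phi>2 \<phi>1 \<longleftrightarrow>
     bigraded_map F3 F2 \<phi>3 \<and> bigraded_map F2 F1 \<phi>2 \<and> bigraded_map F1 [(0,0)] \<phi>1 \<and>
     (\<forall>x\<in>carrier_vec (length F1). (\<phi>1 *\<^sub>v x) $ 0 \<in> J) \<and>
     \<phi>2 * \<phi>3 = 0\<^sub>m (length F1) (length F3) \<and> \<phi>1 * \<phi>2 = 0\<^sub>m 1 (length F2)"

definition F1 :: "(int \<times> int) list" where
  "F1 = [(2,1), (2,1), (2,1), (2,1)]"

definition F2 :: "(int \<times> int) list" where
  "F2 = [(2,2), (3,2), (3,2), (4,1), (4,1)]"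

definition F3 :: "(int \<times> int) list" where
  "F3 = [(4,2), (4,2)]"

definition phi1 :: "'k::comm_ring_1 biring list \<Rightarrow> 'k biring mat" where
  "phi1 ps = mat_of_rows_list (length ps) [ps]"

section \<open>Normal forms\<close>

text \<open>A linear change of variables replaces \<open>s, t\<close> by new coordinates, i.e. by another basis
  \<open>x, y\<close> of the forms of bidegree \<open>(1,0)\<close>. The normal forms and matrices below are
  written in such coordinates, so that they concern \<open>U\<close> itself inside the original ring.\<close>

definition linear_change_st :: "'k::field biring \<Rightarrow> 'k biring \<Rightarrow> bool" where
  "linear_change_st x y \<longleftrightarrow> (\<exists>c11 c12 c21 c22. c11 * c22 - c12 * c21 \<noteq> 0 \<and>
     x = const c11 * var Vs + const c12 * var Vt \<and>
     y = const c21 * var Vs + const c22 * var Vt)"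

text \<open>\<open>a, b\<close> are used at indices \<open>1..4\<close> (the forms \<open>l\<^sub>i\<close>), \<open>\<alpha>, \<beta>\<close> at \<open>1, 2\<close> (the forms
  \<open>L\<^sub>i\<close>).\<close>

definition lin_uv :: "(nat \<Rightarrow> 'k::comm_ring_1) \<Rightarrow> (nat \<Rightarrow> 'k) \<Rightarrow> nat \<Rightarrow> 'k biring" where
  "lin_uv a b i = const (a i) * var Vu + const (b i) * var Vv"

definition quad_form :: "(nat \<Rightarrow> 'k::comm_ring_1) \<Rightarrow> (nat \<Rightarrow> 'k) \<Rightarrow> 'k biring" where
  "quad_form a b = lin_uv a b 1 * lin_uv a b 4 - lin_uv a b 2 * lin_uv a b 3"

definition nf1 ::
    "'k::comm_ring_1 biring \<Rightarrow> 'k biring \<Rightarrow> (nat \<Rightarrow> 'k) \<Rightarrow> (nat \<Rightarrow> 'k) \<Rightarrow> 'k biring list" where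
  "nf1 x y a b = (let l = lin_uv a b in
     [x^2 * var Vu, x^2 * var Vv, x * y * l 1 + y^2 * l 2, x * y * l 3 + y^2 * l 4])"

definition phi2_1 ::
    "'k::comm_ring_1 biring \<Rightarrow> 'k biring \<Rightarrow> (nat \<Rightarrow> 'k) \<Rightarrow> (nat \<Rightarrow> 'k) \<Rightarrow>
     (nat \<Rightarrow> 'k) \<Rightarrow> (nat \<Rightarrow> 'k) \<Rightarrow> 'k biring mat" where
  "phi2_1 x y a b \<alpha> \<beta> = (let u = var Vu; v = var Vv; l = lin_uv a b; L = lin_uv \<alpha> \<beta>;
       a' = \<lambda>i. const (a i); b' = \<lambda>i. const (b i) in
     mat_of_rows_list 5
      [[ v, const (\<alpha> 1) * y * L 2,  0,
         a' 1 * x * y + a' 2 * y^2,  a' 3 * x * y + a' 4 * y^2],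
       [-u, const (\<beta> 1) * y * L 2,  0,
         b' 1 * x * y + b' 2 * y^2,  b' 3 * x * y + b' 4 * y^2],
       [ 0, - x * l 4,    x * l 3 + y * l 4,  - (x^2),  0],
       [ 0,   x * l 2,  - x * l 1 - y * l 2,  0,  - (x^2)]])"

definition phi3_1 ::
    "'k::comm_ring_1 biring \<Rightarrow> 'k biring \<Rightarrow> (nat \<Rightarrow> 'k) \<Rightarrow> (nat \<Rightarrow> 'k) \<Rightarrow>
     (nat \<Rightarrow> 'k) \<Rightarrow> (nat \<Rightarrow> 'k) \<Rightarrow> 'k biring mat" where
  "phi3_1 x y a b \<alpha> \<beta> = (let l = lin_uv a b;
       a' = \<lambda>i. const (a i); b' = \<lambda>i. const (b i);
       \<gamma> = - const (\<alpha> 1 * \<beta> 2) * x * y + (a' 1 * x * y + a' 2 * y^2) * b' 4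
                                         - (a' 3 * x * y + a' 4 * y^2) * b' 2;
       \<delta> = const (\<alpha> 1 * \<beta> 2) * y^2 + (a' 1 * x * y + a' 2 * y^2) * b' 3
                                     - (a' 3 * x * y + a' 4 * y^2) * b' 1 in
     mat_of_rows_list 2
      [[\<gamma>, \<delta>],
       [x, - y],
       [0, - x],
       [- l 4, - l 3],
       [l 2, l 1]])"

definition nf2 ::
    "'k::comm_ring_1 biring \<Rightarrow> 'k biring \<Rightarrow> (nat \<Rightarrow> 'k) \<Rightarrow> (nat \<Rightarrow> 'k) \<Rightarrow> 'k biring list" where
  "nf2 x y a b = (let l = lin_uv a b in
     [x * y * var Vu, x * y * var Vv, x^2 * l 1 + y^2 * l 2, x^2 * l 3 + y^2 * l 4])"

definition phi2_2 ::
    "'k::comm_ring_1 biring \<Rightarrow> 'k biring \<Rightarrow> (nat \<Rightarrow> 'k) \<Rightarrow> (nat \<Rightarrow> 'k) \<Rightarrow>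
     (nat \<Rightarrow> 'k) \<Rightarrow> (nat \<Rightarrow> 'k) \<Rightarrow> 'k biring mat" where
  "phi2_2 x y a b \<alpha> \<beta> = (let u = var Vu; v = var Vv; l = lin_uv a b; L = lin_uv \<alpha> \<beta>;
       a' = \<lambda>i. const (a i); b' = \<lambda>i. const (b i) in
     mat_of_rows_list 5
      [[ v, - const (\<alpha> 1) * y * L 2,  const (\<alpha> 1) * x * L 2,
         a' 1 * x^2 + a' 2 * y^2,  a' 3 * x^2 + a' 4 * y^2],
       [-u, - const (\<beta> 1) * y * L 2,  const (\<beta> 1) * x * L 2,
         b' 1 * x^2 + b' 2 * y^2,  b' 3 * x^2 + b' 4 * y^2],
       [ 0, - x * l 3,  - y * l 4,  - (x * y),  0],
       [ 0,   x * l 1,    y * l 2,  0,  - (x * y)]])"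

definition phi3_2 ::
    "'k::comm_ring_1 biring \<Rightarrow> 'k biring \<Rightarrow> (nat \<Rightarrow> 'k) \<Rightarrow> (nat \<Rightarrow> 'k) \<Rightarrow>
     (nat \<Rightarrow> 'k) \<Rightarrow> (nat \<Rightarrow> 'k) \<Rightarrow> 'k biring mat" where
  "phi3_2 x y a b \<alpha> \<beta> = (let l = lin_uv a b;
       \<gamma> = const (- \<alpha> 1 * \<beta> 2 + a 1 * b 4 - a 3 * b 2) * x^2
           + const (a 2 * b 4 - a 4 * b 2) * y^2;
       \<delta> = const (a 1 * b 3 - a 3 * b 1) * x^2
           + const (\<alpha> 1 * \<beta> 2 + a 2 * b 3 - a 4 * b 1) * y^2 in
     mat_of_rows_list 2
      [[\<gamma>, \<delta>],
       [0, y],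
       [x, 0],
       [- l 4, - l 3],
       [l 2, l 1]])"

text \<open>The shape \<open>I\<^sub>U = \<langle>p u, p v, p2, p3\<rangle>\<close>, the four generators being a basis of \<open>U\<close>.\<close>

definition pencil_basis ::
    "'k::field biring set \<Rightarrow> 'k biring \<Rightarrow> 'k biring \<Rightarrow> 'k biring \<Rightarrow> bool" where
  "pencil_basis W p p2 p3 \<longleftrightarrow> p \<in> R_deg (2,0) \<and>
     list_basis W [p * var Vu, p * var Vv, p2, p3] \<and>
     gen_ideal W = gen_ideal {p * var Vu, p * var Vv, p2, p3}"

definition square_of_linear :: "'k::field biring \<Rightarrow> bool" where
  "square_of_linear p \<longleftrightarrow> (\<exists>l\<in>R_deg (1,0). p = l^2)"

definition product_of_independent_linear :: "'k::field biring \<Rightarrow> bool" where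
  "product_of_independent_linear p \<longleftrightarrow>
     (\<exists>l\<in>R_deg (1,0). \<exists>m\<in>R_deg (1,0). l \<noteq> m \<and> kvs.independent {l, m} \<and> p = l * m)"

end

theory Submission
  imports Defs
begin

text \<open>A \<open>(0,1)\<close>-syzygy of the \<open>f\<^sub>i\<close> has the form \<open>u P + v Q = 0\<close> with \<open>P, Q \<in> U\<close>, which forces
  \<open>P = p v\<close> and \<open>Q = - p u\<close>. Over an algebraically closed field \<open>p\<close> is a square or a product of
  independent linear forms, which serve as new coordinates; subtracting multiples of \<open>p u\<close> and
  \<open>p v\<close> from the other two basis elements gives the normal forms. If \<open>q\<close> vanished, one of
  \<open>(0, 0, l\<^sub>4, - l\<^sub>2)\<close> and \<open>(0, 0, l\<^sub>3, - l\<^sub>1)\<close> would be a second \<open>(0,1)\<close>-syzygy, independent of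
  \<open>(v, - u, 0, 0)\<close>. The entries of \<open>\<phi>\<^sub>2 \<phi>\<^sub>3\<close> and \<open>\<phi>\<^sub>1 \<phi>\<^sub>2\<close> are multiples of the differences
  between the coefficients of \<open>q\<close> and of \<open>L\<^sub>1 L\<^sub>2\<close>.\<close>

section \<open>Monomials and bidegrees\<close>

text \<open>The interpretation \<open>Rmod\<close> turns associativity, oriented to the left, into a default
  simplification rule, on which \<open>algebra_simps\<close> loops.\<close>

declare Rmod.scale_scale [simp del]

section \<open>Coefficients of products with constants and variables\<close>

text \<open>Addition of exponents is cancellative, so \<open>m\<close> is the only exponent of
  \<open>f\<close> that can contribute to the coefficient at \<open>e + m\<close>.\<close>

lemma lookup_single_mult_add:
  fixes f :: "('a::cancel_comm_monoid_add \<Rightarrow>\<^sub>0 'k::comm_ring_1)"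
  shows "Poly_Mapping.lookup (Poly_Mapping.single e c * f) (e + m) = c * Poly_Mapping.lookup f m"
  by (simp add: lookup_mult lookup_single when_mult)

lemma lookup_const_mult [simp]:
  "Poly_Mapping.lookup (const c * f) m = c * Poly_Mapping.lookup f m"
  using lookup_single_mult_add[of 0 c f m] by (simp add: const_def)

lemma lookup_var_mult_add [simp]:
  "Poly_Mapping.lookup (var i * f) (Poly_Mapping.single i 1 + m) = Poly_Mapping.lookup f m"
  using lookup_single_mult_add[of "Poly_Mapping.single i 1" 1 f m] by (simp add: var_def)

lemma lookup_var_mult_eq_0:
  assumes "Poly_Mapping.lookup m i = 0"
  shows "Poly_Mapping.lookup (var i * f) m = 0"
proof -
  have "m \<noteq> Poly_Mapping.single i 1 + q" for q
    using assms by (auto simp: lookup_add)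
  then show ?thesis
    by (simp add: var_def lookup_mult lookup_single when_mult)
qed

lemma const_0 [simp]: "const 0 = 0"
  and const_1 [simp]: "const 1 = 1"
  and const_add: "const (a + b) = const a + const b"
  and const_diff: "const (a - b) = const a - const b"
  and const_uminus: "const (- a) = - const a"
  and const_mult: "const (a * b) = const a * const b"
  by (simp_all add: const_def single_add single_diff single_uminus mult_single)

lemma const_sum: "const (sum f A) = (\<Sum>x\<in>A. const (f x))"
  by (induction A rule: infinite_finite_induct) (simp_all add: const_add)

lemma const_eq_iff [simp]: "const a = const b \<longleftrightarrow> a = b"
  by (metis const_def lookup_single_eq)

lemma const_eq_0_iff [simp]: "const a = 0 \<longleftrightarrow> a = 0"
  using const_eq_iff[of a 0] by simp

text \<open>Every coefficient of \<open>f\<close> recurs in \<open>var i * f\<close> at a shifted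
  monomial, so variables cancel over any commutative coefficient ring.\<close>

lemma var_mult_cancel: "var i * f = var i * g \<Longrightarrow> f = g"
  by (rule poly_mapping_eqI) (metis lookup_var_mult_add)

lemma const_mult_eq_0_iff:
  fixes c :: "'k::field"
  shows "const c * f = 0 \<longleftrightarrow> c = 0 \<or> f = 0"
proof -
  have "f = const (inverse c) * (const c * f)" if "c \<noteq> 0"
    using that by (simp add: mult.assoc[symmetric] const_mult[symmetric])
  then show ?thesis by (metis const_0 mult_zero_left mult_zero_right)
qed

section \<open>Division by variables\<close>

lemma add_single_monomial:
  fixes m :: "bivar \<Rightarrow>\<^sub>0 nat"
  assumes "Poly_Mapping.lookup m i \<noteq> 0"
  obtains m' where "m = Poly_Mapping.single i 1 + m'"
proof
  show "m = Poly_Mapping.single i 1 + (m - Poly_Mapping.single i 1)"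
    using assms
    by (auto intro!: poly_mapping_eqI simp: lookup_add lookup_minus lookup_single when_def)
qed

text \<open>This \<open>g\<close> is the quotient of \<open>f\<close> by \<open>var i\<close>, with
  the monomials free of \<open>i\<close> discarded. The shift of exponents is injective, as
  \<open>map_key\<close> requires.\<close>

lemma shift_exists:
  fixes f :: "'k::comm_ring_1 biring"
  shows "\<exists>g. \<forall>m. Poly_Mapping.lookup g m = Poly_Mapping.lookup f (Poly_Mapping.single i 1 + m)"
proof (intro exI allI)
  show "Poly_Mapping.lookup (Poly_Mapping.map_key (\<lambda>m. Poly_Mapping.single i 1 + m) f) m
      = Poly_Mapping.lookup f (Poly_Mapping.single i 1 + m)" for m
    by (subst map_key.rep_eq) (auto simp: inj_def)
qed

lemma var_dvd_if_keys:
  fixes f :: "'k::comm_ring_1 biring"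
  assumes "\<And>m. Poly_Mapping.lookup m i = 0 \<Longrightarrow> Poly_Mapping.lookup f m = 0"
  obtains g where "f = var i * g"
proof -
  obtain g where g: "\<And>m. Poly_Mapping.lookup g m = Poly_Mapping.lookup f (Poly_Mapping.single i 1 + m)"
    using shift_exists[of f i] by blast
  have "Poly_Mapping.lookup f m = Poly_Mapping.lookup (var i * g) m" for m
  proof (cases "Poly_Mapping.lookup m i = 0")
    case False
    then obtain m' where "m = Poly_Mapping.single i 1 + m'" by (rule add_single_monomial)
    then show ?thesis by (simp add: g del: One_nat_def)
  qed (simp add: assms lookup_var_mult_eq_0)
  then have "f = var i * g" by (rule poly_mapping_eqI)
  then show thesis ..
qed

text \<open>Here \<open>g\<close> collects the terms divisible by the variable \<open>i\<close>; the
  terms left over are free of \<open>i\<close>, hence divisible by \<open>j\<close>. The two clauses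
  about keys serve to transfer bidegrees from \<open>f\<close> to \<open>g\<close> and
  \<open>h\<close>.\<close>

lemma split_two_vars:
  fixes f :: "'k::comm_ring_1 biring"
  assumes "\<And>m. m \<in> Poly_Mapping.keys f \<Longrightarrow> Poly_Mapping.lookup m i \<noteq> 0 \<or> Poly_Mapping.lookup m j \<noteq> 0"
  shows "\<exists>g h. f = var i * g + var j * h \<and>
    (\<forall>m\<in>Poly_Mapping.keys g. Poly_Mapping.single i 1 + m \<in> Poly_Mapping.keys f) \<and>
    (\<forall>m\<in>Poly_Mapping.keys h. Poly_Mapping.single j 1 + m \<in> Poly_Mapping.keys f)"
proof -
  obtain g where g: "\<And>m. Poly_Mapping.lookup g m = Poly_Mapping.lookup f (Poly_Mapping.single i 1 + m)"
    using shift_exists[of f i] by blast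
  define r where "r = f - var i * g"
  have r: "Poly_Mapping.lookup r m =
      (if Poly_Mapping.lookup m i = 0 then Poly_Mapping.lookup f m else 0)" for m
  proof (cases "Poly_Mapping.lookup m i = 0")
    case False
    then obtain m' where "m = Poly_Mapping.single i 1 + m'" by (rule add_single_monomial)
    then show ?thesis using False by (simp add: r_def g lookup_minus del: One_nat_def)
  qed (simp add: r_def lookup_minus lookup_var_mult_eq_0)
  have "Poly_Mapping.lookup r m = 0" if "Poly_Mapping.lookup m j = 0" for m
    using assms[of m] that unfolding r in_keys_iff by metis
  then obtain h where h: "r = var j * h" by (rule var_dvd_if_keys)
  show ?thesis
  proof (intro exI conjI ballI)
    show "f = var i * g + var j * h" using h by (simp add: r_def algebra_simps)
    show "Poly_Mapping.single i 1 + m \<in> Poly_Mapping.keys f" if "m \<in> Poly_Mapping.keys g" for m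
      using that by (simp add: in_keys_iff g)
    show "Poly_Mapping.single j 1 + m \<in> Poly_Mapping.keys f" if "m \<in> Poly_Mapping.keys h" for m
    proof -
      have "Poly_Mapping.lookup r (Poly_Mapping.single j 1 + m) \<noteq> 0"
        using that unfolding h by (simp add: in_keys_iff del: One_nat_def)
      then show ?thesis by (auto simp: r in_keys_iff split: if_splits)
    qed
  qed
qed

section \<open>Arithmetic of bidegrees\<close>

lemma R_degD:
  assumes "f \<in> R_deg (a, b)" "m \<in> Poly_Mapping.keys f"
  shows "int (Poly_Mapping.lookup m Vs) + int (Poly_Mapping.lookup m Vt) = a"
    "int (Poly_Mapping.lookup m Vu) + int (Poly_Mapping.lookup m Vv) = b"
  using assms by (auto simp: R_deg_def)

lemma R_deg_0 [simp]: "0 \<in> R_deg d"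
  by (simp add: R_deg_def)

lemma R_deg_add [simp]: "f \<in> R_deg d \<Longrightarrow> g \<in> R_deg d \<Longrightarrow> f + g \<in> R_deg d"
  using keys_add[of f g] by (auto simp: R_deg_def)

lemma R_deg_uminus [simp]:
  "f \<in> R_deg d \<Longrightarrow> - f \<in> R_deg d" for f :: "'k::comm_ring_1 biring"
  by (auto simp: R_deg_def in_keys_iff)

lemma R_deg_diff [simp]:
  "f \<in> R_deg d \<Longrightarrow> g \<in> R_deg d \<Longrightarrow> f - g \<in> R_deg d" for f :: "'k::comm_ring_1 biring"
  using R_deg_add[of f d "- g"] by simp

lemma R_deg_sum: "(\<And>i. i \<in> I \<Longrightarrow> f i \<in> R_deg d) \<Longrightarrow> sum f I \<in> R_deg d"
  by (induction I rule: infinite_finite_induct) auto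

lemma R_deg_mult:
  "f \<in> R_deg (a, b) \<Longrightarrow> g \<in> R_deg (c, d) \<Longrightarrow> f * g \<in> R_deg (a + c, b + d)"
  using keys_mult[of f g] by (fastforce simp: R_deg_def lookup_add)

lemma R_deg_const [simp]: "const c \<in> R_deg (0, 0)"
  by (simp add: R_deg_def const_def)

lemma R_deg_var [simp]:
  "var Vs \<in> R_deg (1, 0)" "var Vt \<in> R_deg (1, 0)" "var Vu \<in> R_deg (0, 1)" "var Vv \<in> R_deg (0, 1)"
  by (simp_all add: R_deg_def var_def lookup_single)

lemma R_deg_const_mult [simp]:
  "f \<in> R_deg d \<Longrightarrow> const c * f \<in> R_deg d" "f \<in> R_deg d \<Longrightarrow> f * const c \<in> R_deg d"
  using R_deg_mult[OF R_deg_const, of f "fst d" "snd d" c]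
    R_deg_mult[OF _ R_deg_const, of f "fst d" "snd d" c] by simp_all

lemma R_deg_lin_uv [simp]: "lin_uv a b i \<in> R_deg (0, 1)"
  by (simp add: lin_uv_def)

text \<open>Peels one factor of known bidegree off the left, so that a right-associated product is
  checked factor by factor without guessing how the target bidegree splits into a sum.\<close>

lemma R_deg_mult_10: "f \<in> R_deg (1, 0) \<Longrightarrow> g \<in> R_deg (a - 1, b) \<Longrightarrow> f * g \<in> R_deg (a, b)"
  using R_deg_mult[of f 1 0 g "a - 1" b] by simp

lemma R_deg_mult_01: "f \<in> R_deg (0, 1) \<Longrightarrow> g \<in> R_deg (a, b - 1) \<Longrightarrow> f * g \<in> R_deg (a, b)"
  using R_deg_mult[of f 0 1 g a "b - 1"] by simp

lemma R_deg_00E: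
  assumes "f \<in> R_deg (0, 0)"
  obtains c where "f = const c"
proof
  have "m = 0" if "m \<in> Poly_Mapping.keys f" for m
  proof (rule poly_mapping_eqI)
    show "Poly_Mapping.lookup m i = Poly_Mapping.lookup 0 i" for i
      using R_degD[OF assms that] by (cases i) auto
  qed
  then show "f = const (Poly_Mapping.lookup f 0)"
    by (intro poly_mapping_eqI) (auto simp: const_def lookup_single when_def in_keys_iff)
qed

section \<open>Decomposition along degree-one forms\<close>

lemma R_deg_split_st:
  assumes "f \<in> R_deg (a, b)" "a \<ge> 1"
  obtains g h where "g \<in> R_deg (a - 1, b)" "h \<in> R_deg (a - 1, b)" "f = var Vs * g + var Vt * h"
proof -
  have "Poly_Mapping.lookup m Vs \<noteq> 0 \<or> Poly_Mapping.lookup m Vt \<noteq> 0"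
    if "m \<in> Poly_Mapping.keys f" for m
    using R_degD[OF assms(1) that] assms(2) by auto
  then obtain g h where gh: "f = var Vs * g + var Vt * h"
    "\<And>m. m \<in> Poly_Mapping.keys g \<Longrightarrow> Poly_Mapping.single Vs 1 + m \<in> Poly_Mapping.keys f"
    "\<And>m. m \<in> Poly_Mapping.keys h \<Longrightarrow> Poly_Mapping.single Vt 1 + m \<in> Poly_Mapping.keys f"
    using split_two_vars[of f Vs Vt] by blast
  have "g \<in> R_deg (a - 1, b)" "h \<in> R_deg (a - 1, b)"
    using R_degD[OF assms(1) gh(2)] R_degD[OF assms(1) gh(3)]
    by (force simp: R_deg_def lookup_add lookup_single)+
  then show thesis using gh(1) that by blast
qed

lemma R_deg_split_uv:
  assumes "f \<in> R_deg (a, b)" "b \<ge> 1"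
  obtains g h where "g \<in> R_deg (a, b - 1)" "h \<in> R_deg (a, b - 1)" "f = var Vu * g + var Vv * h"
proof -
  have "Poly_Mapping.lookup m Vu \<noteq> 0 \<or> Poly_Mapping.lookup m Vv \<noteq> 0"
    if "m \<in> Poly_Mapping.keys f" for m
    using R_degD[OF assms(1) that] assms(2) by auto
  then obtain g h where gh: "f = var Vu * g + var Vv * h"
    "\<And>m. m \<in> Poly_Mapping.keys g \<Longrightarrow> Poly_Mapping.single Vu 1 + m \<in> Poly_Mapping.keys f"
    "\<And>m. m \<in> Poly_Mapping.keys h \<Longrightarrow> Poly_Mapping.single Vv 1 + m \<in> Poly_Mapping.keys f"
    using split_two_vars[of f Vu Vv] by blast
  have "g \<in> R_deg (a, b - 1)" "h \<in> R_deg (a, b - 1)"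
    using R_degD[OF assms(1) gh(2)] R_degD[OF assms(1) gh(3)]
    by (force simp: R_deg_def lookup_add lookup_single)+
  then show thesis using gh(1) that by blast
qed

lemma R_deg_01E:
  assumes "f \<in> R_deg (0, 1)"
  obtains a b where "f = const a * var Vu + const b * var Vv"
proof -
  obtain g h where "g \<in> R_deg (0, 0)" "h \<in> R_deg (0, 0)" "f = var Vu * g + var Vv * h"
    using R_deg_split_uv[OF assms] by auto
  then show thesis using that by (metis R_deg_00E mult.commute)
qed

lemma R_deg_10E:
  assumes "f \<in> R_deg (1, 0)"
  obtains a b where "f = const a * var Vs + const b * var Vt"
proof -
  obtain g h where "g \<in> R_deg (0, 0)" "h \<in> R_deg (0, 0)" "f = var Vs * g + var Vt * h"
    using R_deg_split_st[OF assms] by auto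
  then show thesis using that by (metis R_deg_00E mult.commute)
qed

lemma linear_change_R_deg:
  assumes "linear_change_st x y"
  shows "x \<in> R_deg (1, 0)" "y \<in> R_deg (1, 0)"
  using assms by (auto simp: linear_change_st_def)

text \<open>Cramer's rule, with \<open>d\<close> the inverse determinant, recovers \<open>s\<close>
  and \<open>t\<close> from \<open>x\<close> and \<open>y\<close>; substituting into the splitting
  along \<open>s, t\<close> and regrouping gives the one along \<open>x, y\<close>.\<close>

lemma R_deg_split_linear_change:
  assumes xy: "linear_change_st x y" and f: "f \<in> R_deg (a, b)" "a \<ge> 1"
  obtains g h where "g \<in> R_deg (a - 1, b)" "h \<in> R_deg (a - 1, b)" "f = x * g + y * h"
proof -
  obtain c11 c12 c21 c22 where c: "c11 * c22 - c12 * c21 \<noteq> 0"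
    and x: "x = const c11 * var Vs + const c12 * var Vt"
    and y: "y = const c21 * var Vs + const c22 * var Vt"
    using xy unfolding linear_change_st_def by blast
  define d where "d = inverse (c11 * c22 - c12 * c21)"
  have d: "const d * (const c11 * const c22 - const c12 * const c21) = 1"
    using c by (simp add: d_def const_mult[symmetric] const_diff[symmetric])
  have "const d * (const c22 * x - const c12 * y)
      = (const d * (const c11 * const c22 - const c12 * const c21)) * var Vs"
    by (simp add: x y algebra_simps)
  with d have s: "var Vs = const d * (const c22 * x - const c12 * y)" by simp
  have "const d * (const c11 * y - const c21 * x)
      = (const d * (const c11 * const c22 - const c12 * const c21)) * var Vt"
    by (simp add: x y algebra_simps)
  with d have t: "var Vt = const d * (const c11 * y - const c21 * x)" by simp
  obtain g h where gh: "g \<in> R_deg (a - 1, b)" "h \<in> R_deg (a - 1, b)" "f = var Vs * g + var Vt * h"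
    using R_deg_split_st[OF f] .
  show thesis
  proof
    show "f = x * (const d * (const c22 * g - const c21 * h)) + y * (const d * (const c11 * h - const c12 * g))"
      unfolding gh(3) s t by (simp add: algebra_simps)
  qed (use gh in simp_all)
qed

lemma R_deg_2_split_linear_change:
  assumes "linear_change_st x y" "f \<in> R_deg (2, b)"
  obtains g h k where "g \<in> R_deg (0, b)" "h \<in> R_deg (0, b)" "k \<in> R_deg (0, b)"
    "f = x^2 * g + x * y * h + y^2 * k"
proof -
  obtain g h where gh: "g \<in> R_deg (1, b)" "h \<in> R_deg (1, b)" "f = x * g + y * h"
    using R_deg_split_linear_change[OF assms] by auto
  obtain g1 g2 where g: "g1 \<in> R_deg (0, b)" "g2 \<in> R_deg (0, b)" "g = x * g1 + y * g2"
    using R_deg_split_linear_change[OF assms(1) gh(1)] by auto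
  obtain h1 h2 where h: "h1 \<in> R_deg (0, b)" "h2 \<in> R_deg (0, b)" "h = x * h1 + y * h2"
    using R_deg_split_linear_change[OF assms(1) gh(2)] by auto
  have "f = x^2 * g1 + x * y * (g2 + h1) + y^2 * h2"
    unfolding gh(3) g(3) h(3) by (simp add: algebra_simps power2_eq_square)
  then show thesis using that g(1,2) h(1,2) R_deg_add by blast
qed

lemma R_deg_20E:
  fixes f :: "'k::field biring"
  assumes "f \<in> R_deg (2, 0)"
  obtains a b c where "f = const a * var Vs^2 + const b * (var Vs * var Vt) + const c * var Vt^2"
proof -
  have "linear_change_st (var Vs) (var Vt :: 'k biring)"
    unfolding linear_change_st_def
    by (intro exI[of _ 1] exI[of _ 0] exI[of _ 0] exI[of _ 1]) simp
  from R_deg_2_split_linear_change[OF this assms] obtain g h k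
    where ghk: "g \<in> R_deg (0, 0)" "h \<in> R_deg (0, 0)" "k \<in> R_deg (0, 0)"
      and f: "f = var Vs^2 * g + var Vs * var Vt * h + var Vt^2 * k" .
  obtain a where g: "g = const a" using ghk(1) by (rule R_deg_00E)
  obtain b where h: "h = const b" using ghk(2) by (rule R_deg_00E)
  obtain c where k: "k = const c" using ghk(3) by (rule R_deg_00E)
  from f show thesis unfolding g h k by (intro that) (simp add: mult.commute)
qed

lemma R_deg_21_linear_changeE:
  assumes "linear_change_st x y" "f \<in> R_deg (2, 1)"
  obtains a1 b1 a2 b2 a3 b3 where
    "f = x^2 * (const a1 * var Vu + const b1 * var Vv) + x * y * (const a2 * var Vu + const b2 * var Vv)
       + y^2 * (const a3 * var Vu + const b3 * var Vv)"
proof -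
  obtain g h k where ghk: "g \<in> R_deg (0, 1)" "h \<in> R_deg (0, 1)" "k \<in> R_deg (0, 1)"
    and f: "f = x^2 * g + x * y * h + y^2 * k"
    using R_deg_2_split_linear_change[OF assms] .
  obtain a1 b1 where g: "g = const a1 * var Vu + const b1 * var Vv" using ghk(1) by (rule R_deg_01E)
  obtain a2 b2 where h: "h = const a2 * var Vu + const b2 * var Vv" using ghk(2) by (rule R_deg_01E)
  obtain a3 b3 where k: "k = const a3 * var Vu + const b3 * var Vv" using ghk(3) by (rule R_deg_01E)
  from f show thesis unfolding g h k by (rule that)
qed

section \<open>Syzygies of \<open>u, v\<close> and independence of monomials\<close>

text \<open>If \<open>m\<close> is free of \<open>v\<close>, then so is \<open>u m\<close>, and a
  term at \<open>u m\<close> cannot be cancelled by any term of \<open>v Q\<close>.\<close>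

lemma syzygy_uv_lookup:
  assumes "var Vu * P + var Vv * Q = 0" "Poly_Mapping.lookup m Vv = 0"
  shows "Poly_Mapping.lookup P m = 0"
proof -
  let ?m = "Poly_Mapping.single Vu 1 + m"
  have "Poly_Mapping.lookup (var Vv * Q) ?m = 0"
    using assms(2) by (intro lookup_var_mult_eq_0) (simp add: lookup_add lookup_single)
  moreover have "Poly_Mapping.lookup (var Vu * P + var Vv * Q) ?m = 0"
    by (simp only: assms(1) lookup_zero)
  ultimately show ?thesis by (simp add: lookup_add del: One_nat_def)
qed

text \<open>This is exactness of the Koszul complex on \<open>u, v\<close> in the middle:
  \<open>P\<close> is divisible by \<open>v\<close> monomial by monomial, and cancelling
  \<open>v\<close> then determines \<open>Q\<close>.\<close>

lemma syzygy_uvE: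
  assumes "var Vu * P + var Vv * Q = 0"
  obtains p where "P = p * var Vv" "Q = - p * var Vu"
proof -
  obtain p where p: "P = var Vv * p"
    using var_dvd_if_keys syzygy_uv_lookup[OF assms] by metis
  have "var Vv * Q = var Vv * (- p * var Vu)"
    using assms unfolding p by (simp add: eq_neg_iff_add_eq_0 algebra_simps)
  then have "Q = - p * var Vu" by (rule var_mult_cancel)
  with p show thesis using that by (simp add: mult.commute)
qed

lemma linear_form_eq_0:
  assumes "const a * var i + const b * var j = 0" "i \<noteq> j"
  shows "a = 0" "b = 0"
proof -
  have *: "Poly_Mapping.lookup (const a * var i + const b * var j) m = 0" for m
    by (simp add: assms(1))
  have "Poly_Mapping.single i (Suc 0) \<noteq> Poly_Mapping.single j (Suc 0)"
    using assms(2) by (metis One_nat_def lookup_single_eq lookup_single_not_eq one_neq_zero)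
  then show "a = 0" "b = 0"
    using *[of "Poly_Mapping.single i 1"] *[of "Poly_Mapping.single j 1"]
    by (simp_all add: lookup_add var_def lookup_single when_def split: if_splits)
qed

text \<open>The three monomials have distinct exponents, so each coefficient can be read off. This
  is what lets the coefficients of \<open>q\<close> and \<open>L\<^sub>1 L\<^sub>2\<close> be
  compared.\<close>

lemma quadratic_form_eq_0:
  assumes "const a * (var i * var i) + const b * (var i * var j) + const c * (var j * var j) = 0" "i \<noteq> j"
  shows "a = 0" "b = 0" "c = 0"
proof -
  let ?e = "\<lambda>i j. Poly_Mapping.single i (Suc 0) + Poly_Mapping.single j (Suc 0) :: bivar \<Rightarrow>\<^sub>0 nat"
  have *: "Poly_Mapping.lookup (const a * (var i * var i) + const b * (var i * var j) + const c * (var j * var j)) m = 0" for m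
    by (simp add: assms(1))
  have neq: "?e i i \<noteq> ?e i j" "?e i i \<noteq> ?e j j" "?e i j \<noteq> ?e j j"
    using assms(2) by (auto simp: poly_mapping_eq_iff fun_eq_iff lookup_add lookup_single when_def)
  show "a = 0" "b = 0" "c = 0"
    using *[of "?e i i"] *[of "?e i j"] *[of "?e j j"] neq neq[symmetric]
    by (simp_all add: lookup_add var_def mult_single lookup_single when_def split: if_splits)
qed

section \<open>Bases and syzygies over the constants\<close>

lemma span_list:
  assumes "x \<in> kvs.span (set ps)"
  shows "\<exists>c. x = (\<Sum>i<length ps. const (c i) * ps ! i)"
  using assms
proof (induction ps arbitrary: x)
  case (Cons p ps)
  then obtain k where "x - kscale k p \<in> kvs.span (set ps)"
    by (auto simp: kvs.span_breakdown_eq)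
  then obtain c where c: "x - kscale k p = (\<Sum>i<length ps. const (c i) * ps ! i)"
    using Cons.IH by blast
  have "x = (\<Sum>i<length (p # ps). const (case i of 0 \<Rightarrow> k | Suc j \<Rightarrow> c j) * (p # ps) ! i)"
    using c
    by (simp add: sum.lessThan_Suc_shift kscale_def algebra_simps del: sum.lessThan_Suc)
  then show ?case by (rule exI[of _ "\<lambda>i. case i of 0 \<Rightarrow> k | Suc j \<Rightarrow> c j"])
qed simp

lemma const_comb_in_span:
  "(\<Sum>i<length ps. const (c i) * ps ! i) \<in> kvs.span (set ps)"
  by (intro kvs.span_sum) (metis kscale_def kvs.span_base kvs.span_scale lessThan_iff nth_mem)

text \<open>Distinctness makes indexing a bijection onto \<open>set ps\<close>; along its inverse
  the coefficients become a function \<open>u\<close> on the set, to which independence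
  applies.\<close>

lemma list_basis_unique_coeffs:
  assumes "list_basis W ps" "(\<Sum>i<length ps. const (c i) * ps ! i) = 0" "i < length ps"
  shows "c i = 0"
proof -
  have bij: "bij_betw ((!) ps) {..<length ps} (set ps)"
    using assms(1) by (intro bij_betw_nth) (auto simp: list_basis_def)
  define u where "u v = c (the_inv_into {..<length ps} ((!) ps) v)" for v
  have u: "u (ps ! i) = c i" if "i < length ps" for i
    using bij that by (auto simp: u_def bij_betw_def the_inv_into_f_f)
  have "(\<Sum>v\<in>set ps. kscale (u v) v) = (\<Sum>i<length ps. kscale (u (ps ! i)) (ps ! i))"
    by (rule sum.reindex_bij_betw[OF bij, symmetric])
  also have "\<dots> = 0"
    using assms(2) by (simp add: u kscale_def)
  finally have "u (ps ! i) = 0"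
    using assms(1,3) by (intro kvs.independentD[of "set ps" "set ps" u]) (auto simp: list_basis_def)
  with u assms(3) show ?thesis by simp
qed

text \<open>A maximal independent subset of a spanning list still spans, so it has at least
  \<open>length ps\<close> elements, which leaves no room for repetitions or dependencies. Being a
  basis thereby reduces to a comparison of spans.\<close>

lemma list_basis_iff_span:
  assumes "kvs.dim W = length ps"
  shows "list_basis W ps \<longleftrightarrow> kvs.span (set ps) = W"
proof
  assume span: "kvs.span (set ps) = W"
  obtain B where B: "B \<subseteq> set ps" "kvs.independent B" "set ps \<subseteq> kvs.span B"
    using kvs.maximal_independent_subset .
  have "W \<subseteq> kvs.span B"
    using B(3) kvs.span_minimal span kvs.subspace_span by blast
  then have "length ps \<le> card B"
    using assms kvs.dim_le_card[of W B] B(1) finite_subset by fastforce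
  moreover have "card B \<le> card (set ps)" "card (set ps) \<le> length ps"
    using B(1) by (simp_all add: card_mono card_length)
  ultimately have "B = set ps" "card (set ps) = length ps"
    using B(1) card_subset_eq[of "set ps" B] by auto
  with B(2) span show "list_basis W ps"
    by (simp add: list_basis_def card_distinct)
qed (simp add: list_basis_def)

text \<open>An ideal is closed under multiplication by constants, so it already contains the span of
  its generators over the constants.\<close>

lemma gen_ideal_span: "gen_ideal (kvs.span B) = gen_ideal B"
proof -
  have "kvs.subspace (Rmod.span B)"
    by (auto simp: kvs.subspace_def kscale_def Rmod.span_zero intro: Rmod.span_add Rmod.span_scale)
  then have "kvs.span B \<subseteq> Rmod.span B"
    by (intro kvs.span_minimal) (auto intro: Rmod.span_base)
  then have "Rmod.span (kvs.span B) \<subseteq> Rmod.span B"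
    by (intro Rmod.span_minimal Rmod.subspace_span)
  moreover have "Rmod.span B \<subseteq> Rmod.span (kvs.span B)"
    by (intro Rmod.span_mono kvs.span_superset)
  ultimately show ?thesis by (simp add: gen_ideal_def)
qed

text \<open>Writing the basis in terms of \<open>fs\<close> carries its \<open>(0,1)\<close>-syzygies injectively to
  \<open>(0,1)\<close>-syzygies of \<open>fs\<close>.\<close>

lemma unique_syzygy_basis:
  fixes fs ps :: "'k::field biring list" and \<alpha> \<beta> \<gamma> \<delta> :: "nat \<Rightarrow> 'k"
  assumes uniq: "unique_syzygy fs (0,1)" and fs: "kvs.span (set fs) = W" and ps: "list_basis W ps"
    and syz1: "(\<Sum>j<length ps. (const (\<alpha> j) * var Vu + const (\<beta> j) * var Vv) * ps ! j) = 0"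
    and syz2: "(\<Sum>j<length ps. (const (\<gamma> j) * var Vu + const (\<delta> j) * var Vv) * ps ! j) = 0"
    and nz1: "\<exists>j<length ps. \<alpha> j \<noteq> 0 \<or> \<beta> j \<noteq> 0"
    and nz2: "\<exists>j<length ps. \<gamma> j \<noteq> 0 \<or> \<delta> j \<noteq> 0"
  shows "\<exists>c. \<forall>j<length ps. \<gamma> j = c * \<alpha> j \<and> \<delta> j = c * \<beta> j"
proof -
  let ?n = "length ps" and ?m = "length fs"
  have "\<exists>C. ps ! j = (\<Sum>i<?m. const (C i) * fs ! i)" if "j < ?n" for j
    using that ps fs by (intro span_list) (metis list_basis_def kvs.span_base nth_mem)
  then obtain C where C: "\<And>j. j < ?n \<Longrightarrow> ps ! j = (\<Sum>i<?m. const (C j i) * fs ! i)"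
    by metis
  \<comment> \<open>\<open>T\<close> turns coefficients with respect to \<open>ps\<close> into
    coefficients of the same element with respect to \<open>fs\<close>.\<close>
  define T where "T \<alpha> i = (\<Sum>j<?n. C j i * \<alpha> j)" for \<alpha> i
  have T: "(\<Sum>i<?m. const (T \<alpha> i) * fs ! i) = (\<Sum>j<?n. const (\<alpha> j) * ps ! j)" for \<alpha>
  proof -
    have "(\<Sum>i<?m. const (T \<alpha> i) * fs ! i) = (\<Sum>i<?m. \<Sum>j<?n. const (\<alpha> j) * (const (C j i) * fs ! i))"
      unfolding T_def const_sum const_mult sum_distrib_right by (simp add: mult_ac)
    also have "\<dots> = (\<Sum>j<?n. const (\<alpha> j) * (\<Sum>i<?m. const (C j i) * fs ! i))"
      by (subst sum.swap) (simp add: sum_distrib_left)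
    finally show ?thesis by (simp add: C)
  qed
  \<comment> \<open>If all \<open>T \<alpha> i\<close> vanish, the represented element is zero, and
    independence of \<open>ps\<close> applies.\<close>
  have T_inj: "\<forall>j<?n. \<alpha> j = 0" if "\<And>i. i < ?m \<Longrightarrow> T \<alpha> i = 0" for \<alpha>
  proof -
    have "(\<Sum>j<?n. const (\<alpha> j) * ps ! j) = 0"
      using T[of \<alpha>] that by simp
    then show ?thesis using list_basis_unique_coeffs[OF ps] by blast
  qed
  \<comment> \<open>The syzygy is transported by applying \<open>T\<close> to its
    \<open>u\<close>-coefficients and its \<open>v\<close>-coefficients separately.\<close>
  define G where "G \<alpha> \<beta> = vec ?m (\<lambda>i. const (T \<alpha> i) * var Vu + const (T \<beta> i) * var Vv)" for \<alpha> \<beta>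
  have G: "is_syzygy fs (0,1) (G \<alpha> \<beta>)"
    if syz: "(\<Sum>j<?n. (const (\<alpha> j) * var Vu + const (\<beta> j) * var Vv) * ps ! j) = 0"
      and nz: "\<exists>j<?n. \<alpha> j \<noteq> 0 \<or> \<beta> j \<noteq> 0" for \<alpha> \<beta>
  proof -
    have "G \<alpha> \<beta> \<noteq> 0\<^sub>v ?m"
    proof
      assume 0: "G \<alpha> \<beta> = 0\<^sub>v ?m"
      have *: "const (T \<alpha> i) * var Vu + const (T \<beta> i) * var Vv = 0" if "i < ?m" for i
        using arg_cong[OF 0, of "\<lambda>v. v $ i"] that by (simp add: G_def)
      have z: "T \<alpha> i = 0" "T \<beta> i = 0" if "i < ?m" for i
        using linear_form_eq_0[OF *[OF that]] by simp_all
      have "\<forall>j<?n. \<alpha> j = 0" "\<forall>j<?n. \<beta> j = 0"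
        using T_inj[OF z(1)] T_inj[OF z(2)] by blast+
      with nz show False by blast
    qed
    moreover have "(\<Sum>i<?m. G \<alpha> \<beta> $ i * fs ! i)
        = var Vu * (\<Sum>i<?m. const (T \<alpha> i) * fs ! i) + var Vv * (\<Sum>i<?m. const (T \<beta> i) * fs ! i)"
      by (simp add: G_def sum_distrib_left sum.distrib distrib_right distrib_left mult_ac)
    moreover have "\<dots> = (\<Sum>j<?n. (const (\<alpha> j) * var Vu + const (\<beta> j) * var Vv) * ps ! j)"
      unfolding T by (simp add: sum_distrib_left sum.distrib distrib_right distrib_left mult_ac)
    ultimately show ?thesis
      by (simp add: is_syzygy_def syz) (simp add: G_def)
  qed
  obtain g where g: "\<And>h. is_syzygy fs (0,1) h \<Longrightarrow> \<exists>c. c \<noteq> 0 \<and> h = const c \<cdot>\<^sub>v g" and "is_syzygy fs (0,1) g"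
    using uniq by (auto simp: unique_syzygy_def)
  then have dim_g: "dim_vec g = ?m" by (auto simp: is_syzygy_def)
  obtain c1 where c1: "c1 \<noteq> 0" "G \<alpha> \<beta> = const c1 \<cdot>\<^sub>v g"
    using g[OF G[OF syz1 nz1]] by blast
  obtain c2 where c2: "G \<gamma> \<delta> = const c2 \<cdot>\<^sub>v g"
    using g[OF G[OF syz2 nz2]] by blast
  \<comment> \<open>Both transported syzygies are multiples of \<open>g\<close>, the first with the
    nonzero factor \<open>c1\<close>, so the second is \<open>c\<close> times the first; injectivity
    of \<open>T\<close> carries this back to \<open>ps\<close>.\<close>
  define c where "c = c2 / c1"
  have T_lin: "T (\<lambda>j. \<gamma> j - c * \<alpha> j) i = T \<gamma> i - c * T \<alpha> i" for \<alpha> \<gamma> i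
    by (simp add: T_def right_diff_distrib sum_subtractf sum_distrib_left mult_ac)
  have *: "const (T \<gamma> i - c * T \<alpha> i) * var Vu + const (T \<delta> i - c * T \<beta> i) * var Vv = 0" if "i < ?m" for i
  proof -
    have "const (T \<alpha> i) * var Vu + const (T \<beta> i) * var Vv = const c1 * g $ i"
      using arg_cong[OF c1(2), of "\<lambda>v. v $ i"] that by (simp add: G_def dim_g)
    moreover have "const (T \<gamma> i) * var Vu + const (T \<delta> i) * var Vv = const c2 * g $ i"
      using arg_cong[OF c2, of "\<lambda>v. v $ i"] that by (simp add: G_def dim_g)
    moreover have "const c2 = const c * const c1"
      using c1(1) by (simp add: c_def const_mult[symmetric])
    ultimately have "const (T \<gamma> i) * var Vu + const (T \<delta> i) * var Vv
        = const c * (const (T \<alpha> i) * var Vu + const (T \<beta> i) * var Vv)"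
      by (simp add: mult.assoc)
    then show ?thesis
      by (simp add: const_diff const_mult algebra_simps)
  qed
  have z: "T (\<lambda>j. \<gamma> j - c * \<alpha> j) i = 0" "T (\<lambda>j. \<delta> j - c * \<beta> j) i = 0" if "i < ?m" for i
    using linear_form_eq_0[OF *[OF that]] by (simp_all add: T_lin)
  have "\<forall>j<?n. \<gamma> j - c * \<alpha> j = 0" "\<forall>j<?n. \<delta> j - c * \<beta> j = 0"
    using T_inj[OF z(1)] T_inj[OF z(2)] by blast+
  then show ?thesis by (intro exI[of _ c]) simp
qed

section \<open>Linear and quadratic forms\<close>

text \<open>The condition \<open>x \<noteq> y\<close> belongs to the left side because for
  \<open>x = y\<close> the set \<open>{x, y}\<close> collapses to a singleton, which may well be
  independent.\<close>

lemma independent_pair_iff: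
  fixes x y :: "'k::field biring"
  shows "x \<noteq> y \<and> kvs.independent {x, y} \<longleftrightarrow> (\<forall>a b. const a * x + const b * y = 0 \<longrightarrow> a = 0 \<and> b = 0)"
    (is "?L \<longleftrightarrow> ?R")
proof
  assume ?L
  then have *: "list_basis (kvs.span {x, y}) [x, y]" by (simp add: list_basis_def)
  show ?R
  proof (intro allI impI)
    fix a b assume "const a * x + const b * y = 0"
    then have "(\<Sum>i<length [x, y]. const (((\<lambda>_. b)(0 := a)) i) * [x, y] ! i) = 0"
      by (simp add: lessThan_Suc numeral_2_eq_2 add.commute)
    from list_basis_unique_coeffs[OF * this, of 0] list_basis_unique_coeffs[OF * this, of 1]
    show "a = 0 \<and> b = 0" by simp
  qed
next
  assume R: ?R
  have "x \<noteq> y" using R[rule_format, of 1 "-1"] by (auto simp: const_uminus)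
  moreover have "y \<noteq> 0" using R[rule_format, of 0 1] by auto
  moreover have "x \<notin> kvs.span {y}"
  proof
    assume "x \<in> kvs.span {y}"
    then obtain k where "x = kscale k y" by (auto simp: kvs.span_singleton)
    with R[rule_format, of 1 "-k"] show False by (simp add: kscale_def const_uminus)
  qed
  ultimately show ?L by (simp add: kvs.independent_insert)
qed

text \<open>Since \<open>p\<close> is free of \<open>v\<close>, a relation
  \<open>c p u + d p v = 0\<close> forces \<open>c p = 0\<close> coefficient by coefficient;
  cancelling \<open>v\<close> then gives \<open>d p = 0\<close>.\<close>

lemma independent_pu_pv:
  fixes p :: "'k::field biring"
  assumes p: "p \<in> R_deg (a, 0)" "p \<noteq> 0"
  shows "p * var Vu \<noteq> p * var Vv \<and> kvs.independent {p * var Vu, p * var Vv}"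
  unfolding independent_pair_iff
proof (intro allI impI)
  fix c d assume "const c * (p * var Vu) + const d * (p * var Vv) = 0"
  then have *: "var Vu * (const c * p) + var Vv * (const d * p) = 0"
    by (simp add: algebra_simps)
  have "Poly_Mapping.lookup (const c * p) m = 0" for m
    using syzygy_uv_lookup[OF *, of m] R_degD(2)[OF p(1), of m] by (cases "m \<in> Poly_Mapping.keys p") (auto simp: in_keys_iff)
  then have "const c * p = 0" by (intro poly_mapping_eqI) simp
  moreover from this * have "var Vv * (const d * p) = var Vv * 0" by simp
  then have "const d * p = 0" by (rule var_mult_cancel)
  ultimately show "c = 0 \<and> d = 0" using p(2) by (simp add: const_mult_eq_0_iff)
qed

text \<open>Up to sign, \<open>c22 l - c12 m\<close> and \<open>c21 l - c11 m\<close> are the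
  determinant times \<open>s\<close> and \<open>t\<close>. If it vanished, independence would give
  \<open>c12 = 0\<close> and \<open>c11 = 0\<close>, hence \<open>l = 0\<close>.\<close>

lemma linear_change_independent:
  assumes "l \<in> R_deg (1, 0)" "m \<in> R_deg (1, 0)" "l \<noteq> m" "kvs.independent {l, m}"
  shows "linear_change_st l m"
proof -
  have indep: "a = 0 \<and> b = 0" if "const a * l + const b * m = 0" for a b
    using assms(3,4) that independent_pair_iff by blast
  obtain c11 c12 where l: "l = const c11 * var Vs + const c12 * var Vt" using assms(1) by (rule R_deg_10E)
  obtain c21 c22 where m: "m = const c21 * var Vs + const c22 * var Vt" using assms(2) by (rule R_deg_10E)
  have "c11 * c22 - c12 * c21 \<noteq> 0"
  proof
    assume "c11 * c22 - c12 * c21 = 0"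
    then have det: "const c11 * const c22 = const c12 * const c21" by (simp add: const_mult[symmetric])
    have "const c22 * l + const (- c12) * m = (const c11 * const c22 - const c12 * const c21) * var Vs"
      by (simp add: l m const_uminus algebra_simps)
    with det have "c12 = 0" using indep[of c22 "- c12"] by simp
    moreover have "const c21 * l + const (- c11) * m = (const c12 * const c21 - const c11 * const c22) * var Vt"
      by (simp add: l m const_uminus algebra_simps)
    with det have "c11 = 0" using indep[of c21 "- c11"] by simp
    ultimately have "const 1 * l + const 0 * m = 0" by (simp add: l)
    then show False using indep[of 1 0] by simp
  qed
  with l m show ?thesis by (auto simp: linear_change_st_def)
qed

lemma linear_change_complement:
  assumes "l \<in> R_deg (1, 0)" "l \<noteq> 0"
  obtains y where "linear_change_st l y"
proof -
  obtain a b where l: "l = const a * var Vs + const b * var Vt" using assms(1) by (rule R_deg_10E)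
  show thesis
  proof (cases "a = 0")
    case True
    with l assms(2) have "b \<noteq> 0" by auto
    with True l have "linear_change_st l (var Vs)"
      unfolding linear_change_st_def
      by (intro exI[of _ a] exI[of _ b] exI[of _ 1] exI[of _ 0]) simp
    then show thesis ..
  next
    case False
    with l have "linear_change_st l (var Vt)"
      unfolding linear_change_st_def
      by (intro exI[of _ a] exI[of _ b] exI[of _ 0] exI[of _ 1]) simp
    then show thesis ..
  qed
qed

section \<open>Factorisation of binary quadratic forms\<close>

text \<open>A root \<open>r\<close> of \<open>A z^2 + B z + C\<close> yields the factor
  \<open>X - r Y\<close>; for \<open>A = 0\<close> the factor is \<open>Y\<close>. The factorisation
  holds for arbitrary ring elements \<open>X, Y\<close>, so it serves for both \<open>s, t\<close>
  and \<open>u, v\<close>.\<close>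

lemma binary_quadratic_factor:
  fixes A B C :: "'k::alg_closed_field"
  obtains a1 b1 a2 b2 where
    "\<And>X Y. const A * X^2 + const B * (X * Y) + const C * Y^2
       = (const a1 * X + const b1 * Y) * (const a2 * X + const b2 * Y)"
proof (cases "A = 0")
  case True
  show thesis
    by (rule that[of 0 1 B C]) (simp add: True algebra_simps power2_eq_square)
next
  case False
  obtain r where "poly [:C, B, A:] r = 0"
    using alg_closed_imp_poly_has_root[of "[:C, B, A:]"] False by auto
  then have "C = - r * (B + A * r)"
    by (simp add: algebra_simps) (metis add.commute eq_neg_iff_add_eq_0 add.assoc)
  then have C: "const C = - const r * (const B + const A * const r)"
    by (simp add: const_add const_mult const_uminus)
  show thesis
  proof (rule that)
    show "const A * X^2 + const B * (X * Y) + const C * Y^2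
        = (const 1 * X + const (- r) * Y) * (const A * X + const (B + A * r) * Y)" for X Y
      unfolding C const_add const_mult const_uminus power2_eq_square by (simp add: algebra_simps)
  qed
qed

text \<open>If the two linear factors are dependent, then \<open>p = c w^2\<close>, and a square
  root of \<open>c\<close> is absorbed into \<open>w\<close>.\<close>

lemma R_deg_20_factor:
  fixes p :: "'k::alg_closed_field biring"
  assumes "p \<in> R_deg (2, 0)"
  shows "square_of_linear p \<or> product_of_independent_linear p"
proof -
  obtain A B C where "p = const A * var Vs^2 + const B * (var Vs * var Vt) + const C * var Vt^2"
    using assms by (rule R_deg_20E)
  then obtain l m where lm: "l \<in> R_deg (1, 0)" "m \<in> R_deg (1, 0)" "p = l * m"
    using binary_quadratic_factor[of A B C]
    by (metis R_deg_add R_deg_const_mult(1) R_deg_var(1,2))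
  show ?thesis
  proof (cases "l \<noteq> m \<and> kvs.independent {l, m}")
    case True
    with lm show ?thesis by (auto simp: product_of_independent_linear_def)
  next
    case False
    then obtain a b where ab: "const a * l + const b * m = 0" "a \<noteq> 0 \<or> b \<noteq> 0"
      unfolding independent_pair_iff by blast
    \<comment> \<open>For nonzero \<open>a\<close> the factor \<open>l\<close> is a multiple of
      \<open>m\<close>; otherwise \<open>m = 0\<close>, so \<open>p = 0\<close> and both
      \<open>c\<close> and \<open>w\<close> can be taken to be zero.\<close>
    obtain c w where w: "w \<in> R_deg (1, 0)" "p = const c * w^2"
    proof (cases "a = 0")
      case False
      have "const a * (l + const (b / a) * m) = 0"
        using ab(1) False by (simp add: algebra_simps const_mult[symmetric] mult.assoc[symmetric])
      then have "l = const (- (b / a)) * m"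
        using False by (simp add: const_mult_eq_0_iff const_uminus eq_neg_iff_add_eq_0)
      then show thesis using lm by (intro that[of m "- (b / a)"]) (simp_all add: power2_eq_square mult.assoc)
    next
      case True
      with ab have "m = 0" by (simp add: const_mult_eq_0_iff)
      then show thesis using lm that[of 0 0] by simp
    qed
    obtain r where r: "r^2 = c" using nth_root_exists[of 2 c] by auto
    have "p = (const r * w)^2"
      unfolding w(2) r[symmetric] by (simp add: power2_eq_square const_mult algebra_simps)
    with w(1) show ?thesis by (auto simp: square_of_linear_def)
  qed
qed

text \<open>Comparison of the coefficients at \<open>u^2\<close>, \<open>u v\<close> and
  \<open>v^2\<close>. The equations relate constants inside the ring, the form in which they occur
  in the matrix entries.\<close>

lemma quad_form_coeffs:
  assumes "quad_form a b = lin_uv \<alpha> \<beta> 1 * lin_uv \<alpha> \<beta> 2"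
  shows "const (\<alpha> 1) * const (\<alpha> 2) = const (a 1) * const (a 4) - const (a 2) * const (a 3)"
    and "const (\<alpha> 1) * const (\<beta> 2) + const (\<beta> 1) * const (\<alpha> 2)
      = const (a 1) * const (b 4) + const (b 1) * const (a 4)
        - const (a 2) * const (b 3) - const (b 2) * const (a 3)"
    and "const (\<beta> 1) * const (\<beta> 2) = const (b 1) * const (b 4) - const (b 2) * const (b 3)"
proof -
  define A B C where "A = a 1 * a 4 - a 2 * a 3 - \<alpha> 1 * \<alpha> 2"
    and "B = a 1 * b 4 + b 1 * a 4 - a 2 * b 3 - b 2 * a 3 - \<alpha> 1 * \<beta> 2 - \<beta> 1 * \<alpha> 2"
    and "C = b 1 * b 4 - b 2 * b 3 - \<beta> 1 * \<beta> 2"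
  have "const A * (var Vu * var Vu) + const B * (var Vu * var Vv) + const C * (var Vv * var Vv)
      = quad_form a b - lin_uv \<alpha> \<beta> 1 * lin_uv \<alpha> \<beta> 2"
    unfolding A_def B_def C_def quad_form_def lin_uv_def const_diff const_add const_mult
    by (simp add: algebra_simps)
  also have "\<dots> = 0" using assms by simp
  finally have *: "const A * (var Vu * var Vu) + const B * (var Vu * var Vv) + const C * (var Vv * var Vv) = 0" .
  have "const A = 0" "const B = 0" "const C = 0"
    using quadratic_form_eq_0[OF *] by simp_all
  then show "const (\<alpha> 1) * const (\<alpha> 2) = const (a 1) * const (a 4) - const (a 2) * const (a 3)"
    and "const (\<alpha> 1) * const (\<beta> 2) + const (\<beta> 1) * const (\<alpha> 2)
      = const (a 1) * const (b 4) + const (b 1) * const (a 4)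
        - const (a 2) * const (b 3) - const (b 2) * const (a 3)"
    and "const (\<beta> 1) * const (\<beta> 2) = const (b 1) * const (b 4) - const (b 2) * const (b 3)"
    unfolding A_def B_def C_def const_diff const_add const_mult by (simp_all add: algebra_simps)
qed

lemma quad_form_factor:
  fixes a b :: "nat \<Rightarrow> 'k::alg_closed_field"
  shows "\<exists>\<alpha> \<beta>. quad_form a b = lin_uv \<alpha> \<beta> 1 * lin_uv \<alpha> \<beta> 2"
proof -
  obtain a1 b1 a2 b2 where *: "\<And>X Y. const (a 1 * a 4 - a 2 * a 3) * X^2
      + const (a 1 * b 4 + b 1 * a 4 - a 2 * b 3 - b 2 * a 3) * (X * Y) + const (b 1 * b 4 - b 2 * b 3) * Y^2
       = (const a1 * X + const b1 * Y) * (const a2 * X + const b2 * Y)"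
    using binary_quadratic_factor[of "a 1 * a 4 - a 2 * a 3" _ "b 1 * b 4 - b 2 * b 3"] by blast
  have "quad_form a b = const (a 1 * a 4 - a 2 * a 3) * var Vu^2
      + const (a 1 * b 4 + b 1 * a 4 - a 2 * b 3 - b 2 * a 3) * (var Vu * var Vv)
      + const (b 1 * b 4 - b 2 * b 3) * var Vv^2"
    unfolding quad_form_def lin_uv_def const_diff const_add const_mult power2_eq_square
    by (simp add: algebra_simps)
  also note *
  finally show ?thesis
    \<comment> \<open>Index \<open>1\<close> carries the first factor, and the default value, read
      at index \<open>2\<close>, the second.\<close>
    by (intro exI[of _ "(\<lambda>_. a2)(1 := a1)"] exI[of _ "(\<lambda>_. b2)(1 := b1)"]) (simp add: lin_uv_def)
qed

section \<open>The complexes\<close>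

text \<open>When each entry has the difference of the generator degrees as its bidegree, the twist
  of the source cancels in \<open>A $$ (i, j) * x $ j\<close>, so all summands of a component lie in
  the same piece.\<close>

lemma bigraded_mapI:
  fixes A :: "'k::comm_ring_1 biring mat"
  assumes A: "A \<in> carrier_mat (length G) (length F)"
    and deg: "\<And>i j. i < length G \<Longrightarrow> j < length F \<Longrightarrow>
      A $$ (i, j) \<in> R_deg (fst (F ! j) - fst (G ! i), snd (F ! j) - snd (G ! i))"
  shows "bigraded_map F G A"
  unfolding bigraded_map_def
proof (intro conjI allI ballI)
  fix d and x :: "'k biring vec" assume x: "x \<in> free_piece F d"
  then have x_carrier: "x \<in> carrier_vec (length F)" by (simp add: free_piece_def)
  have "(A *\<^sub>v x) $ i \<in> R_deg (fst d - fst (G ! i), snd d - snd (G ! i))" if i: "i < length G" for i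
  proof -
    have "A $$ (i, j) * x $ j \<in> R_deg (fst d - fst (G ! i), snd d - snd (G ! i))"
      if j: "j < length F" for j
    proof -
      have "x $ j \<in> R_deg (fst d - fst (F ! j), snd d - snd (F ! j))"
        using x j by (simp add: free_piece_def)
      from R_deg_mult[OF deg[OF i j] this] show ?thesis by simp
    qed
    then have "(\<Sum>j<length F. A $$ (i, j) * x $ j) \<in> R_deg (fst d - fst (G ! i), snd d - snd (G ! i))"
      by (intro R_deg_sum) simp
    moreover have "(A *\<^sub>v x) $ i = (\<Sum>j<length F. A $$ (i, j) * x $ j)"
      using A x_carrier i by (auto simp: scalar_prod_def atLeast0LessThan intro!: sum.cong)
    ultimately show ?thesis by simp
  qed
  then show "A *\<^sub>v x \<in> free_piece G d"
    using A x_carrier by (simp add: free_piece_def)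
qed (rule A)

lemma phi1_mult_vec:
  assumes "x \<in> carrier_vec (length ps)"
  shows "(phi1 ps *\<^sub>v x) $ 0 = (\<Sum>i<length ps. ps ! i * x $ i)"
  using assms
  by (auto simp: phi1_def mat_of_rows_list_def scalar_prod_def atLeast0LessThan intro!: sum.cong)

lemma phi1_in_gen_ideal:
  assumes "list_basis W ps" "x \<in> carrier_vec (length ps)"
  shows "(phi1 ps *\<^sub>v x) $ 0 \<in> gen_ideal W"
proof -
  have "ps ! i * x $ i \<in> Rmod.span W" if "i < length ps" for i
  proof -
    have "ps ! i \<in> W"
      using assms(1) that by (auto simp: list_basis_def intro: kvs.span_base)
    from Rmod.span_scale[OF Rmod.span_base[OF this], of "x $ i"] show ?thesis
      by (simp add: mult.commute)
  qed
  then show ?thesis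
    unfolding phi1_mult_vec[OF assms(2)] gen_ideal_def by (intro Rmod.span_sum) simp
qed

section \<open>Nonvanishing of \<open>q\<close>\<close>

text \<open>Both normal forms are instances, with \<open>(p, x, y)\<close> read as
  \<open>(x^2, x y, y^2)\<close> or \<open>(x y, x^2, y^2)\<close>. For the last two basis elements
  \<open>p2, p3\<close>, elimination gives \<open>l\<^sub>4 p2 - l\<^sub>2 p3 = x q\<close> and
  \<open>l\<^sub>3 p2 - l\<^sub>1 p3 = - y q\<close>. With \<open>q = 0\<close> both are relations,
  so uniqueness makes every \<open>l\<^sub>i\<close> zero, and the basis would contain zero.\<close>

lemma quad_form_nonzero:
  fixes fs :: "'k::field biring list"
  assumes uniq: "unique_syzygy fs (0,1)" and fs: "kvs.span (set fs) = W"
    and basis: "list_basis W [p * var Vu, p * var Vv, x * lin_uv a b 1 + y * lin_uv a b 2,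
      x * lin_uv a b 3 + y * lin_uv a b 4]"
  shows "quad_form a b \<noteq> 0"
proof
  assume q: "quad_form a b = 0"
  let ?ps = "[p * var Vu, p * var Vv, x * lin_uv a b 1 + y * lin_uv a b 2,
      x * lin_uv a b 3 + y * lin_uv a b 4]"
  \<comment> \<open>A relation between the last two basis elements must be proportional to
    \<open>(v, - u, 0, 0)\<close>, which is zero in those places.\<close>
  have vanish: "m1 = 0 \<and> n1 = 0 \<and> m2 = 0 \<and> n2 = 0"
    if "(const m1 * var Vu + const n1 * var Vv) * ?ps ! 2 + (const m2 * var Vu + const n2 * var Vv) * ?ps ! 3 = 0"
    for m1 n1 m2 n2
  proof (rule ccontr)
    assume nz: "\<not> ?thesis"
    \<comment> \<open>\<open>\<alpha>, \<beta>\<close> are the \<open>u\<close>- and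
      \<open>v\<close>-coefficients of \<open>(v, - u, 0, 0)\<close>, and
      \<open>\<gamma>, \<delta>\<close> those of the given relation.\<close>
    define \<alpha> \<beta> \<gamma> \<delta> :: "nat \<Rightarrow> 'k" where
      "\<alpha> = (\<lambda>_. 0)(1 := -1)" and "\<beta> = (\<lambda>_. 0)(0 := 1)" and
      "\<gamma> = (\<lambda>_. 0)(2 := m1, 3 := m2)" and "\<delta> = (\<lambda>_. 0)(2 := n1, 3 := n2)"
    have 1: "(\<Sum>j<length ?ps. (const (\<alpha> j) * var Vu + const (\<beta> j) * var Vv) * ?ps ! j) = 0"
      by (simp add: \<alpha>_def \<beta>_def lessThan_Suc const_uminus algebra_simps)
    have 2: "(\<Sum>j<length ?ps. (const (\<gamma> j) * var Vu + const (\<delta> j) * var Vv) * ?ps ! j) = 0"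
      using that by (simp add: \<gamma>_def \<delta>_def lessThan_Suc numeral_2_eq_2 numeral_3_eq_3 add.commute)
    have 3: "\<exists>j<length ?ps. \<alpha> j \<noteq> 0 \<or> \<beta> j \<noteq> 0"
      by (intro exI[of _ 0]) (simp add: \<alpha>_def \<beta>_def)
    have 4: "\<exists>j<length ?ps. \<gamma> j \<noteq> 0 \<or> \<delta> j \<noteq> 0"
    proof (cases "m1 = 0 \<and> n1 = 0")
      case True
      then show ?thesis using nz by (intro exI[of _ 3]) (auto simp: \<gamma>_def \<delta>_def)
    next
      case False
      then show ?thesis by (intro exI[of _ 2]) (auto simp: \<gamma>_def \<delta>_def)
    qed
    obtain c where c: "\<forall>j<length ?ps. \<gamma> j = c * \<alpha> j \<and> \<delta> j = c * \<beta> j"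
      using unique_syzygy_basis[OF uniq fs basis 1 2 3 4] by blast
    from c[rule_format, of 2] c[rule_format, of 3] nz show False
      by (simp add: \<alpha>_def \<beta>_def \<gamma>_def \<delta>_def)
  qed
  have det: "lin_uv a b 1 * lin_uv a b 4 = lin_uv a b 2 * lin_uv a b 3"
    using q by (simp add: quad_form_def)
  have "lin_uv a b 4 * ?ps ! 2 - lin_uv a b 2 * ?ps ! 3
      = x * (lin_uv a b 1 * lin_uv a b 4 - lin_uv a b 2 * lin_uv a b 3)"
    by (simp add: algebra_simps)
  also have "\<dots> = 0" using det by simp
  finally have "a 4 = 0 \<and> b 4 = 0 \<and> - a 2 = 0 \<and> - b 2 = 0"
    by (intro vanish) (simp add: lin_uv_def const_uminus algebra_simps)
  moreover have "lin_uv a b 3 * ?ps ! 2 - lin_uv a b 1 * ?ps ! 3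
      = y * (lin_uv a b 2 * lin_uv a b 3 - lin_uv a b 1 * lin_uv a b 4)"
    by (simp add: algebra_simps)
  then have "lin_uv a b 3 * ?ps ! 2 - lin_uv a b 1 * ?ps ! 3 = 0"
    using det by simp
  then have "a 3 = 0 \<and> b 3 = 0 \<and> - a 1 = 0 \<and> - b 1 = 0"
    by (intro vanish) (simp add: lin_uv_def const_uminus algebra_simps)
  ultimately have "?ps ! 2 = 0" by (simp add: lin_uv_def)
  moreover have "?ps ! 2 \<in> set ?ps" by simp
  ultimately have "0 \<in> set ?ps" by simp
  then show False using basis kvs.dependent_zero unfolding list_basis_def by blast
qed

section \<open>Verification of the two complexes\<close>

text \<open>Reduces both cases to finitely many conditions on single entries, with numerals as
  bounds so that they can be unrolled and computed.\<close>

lemma complexI: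
  fixes ps :: "'k::field biring list"
  assumes basis: "list_basis W ps" and len: "length ps = 4"
    and ps: "\<And>i. i < 4 \<Longrightarrow> ps ! i \<in> R_deg (2, 1)"
    and A: "A \<in> carrier_mat 5 2" and B: "B \<in> carrier_mat 4 5"
    and degA: "\<And>i j. i < 5 \<Longrightarrow> j < 2 \<Longrightarrow>
      A $$ (i, j) \<in> R_deg (fst (F3 ! j) - fst (F2 ! i), snd (F3 ! j) - snd (F2 ! i))"
    and degB: "\<And>i j. i < 4 \<Longrightarrow> j < 5 \<Longrightarrow>
      B $$ (i, j) \<in> R_deg (fst (F2 ! j) - fst (F1 ! i), snd (F2 ! j) - snd (F1 ! i))"
    and BA: "\<And>i j. i < 4 \<Longrightarrow> j < 2 \<Longrightarrow> (\<Sum>k<5. B $$ (i, k) * A $$ (k, j)) = 0"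
    and psB: "\<And>j. j < 5 \<Longrightarrow> (\<Sum>k<4. ps ! k * B $$ (k, j)) = 0"
  shows "bigraded_complex F3 F2 F1 (gen_ideal W) A B (phi1 ps)"
proof -
  have lens: "length F3 = 2" "length F2 = 5" "length F1 = 4"
    by (simp_all add: F3_def F2_def F1_def)
  have F1: "F1 ! i = (2, 1)" if "i < 4" for i
    using that by (auto simp: F1_def nth_Cons' less_Suc_eq numeral_eq_Suc)
  have phi1: "phi1 ps \<in> carrier_mat 1 4" "phi1 ps $$ (0, i) = ps ! i" if "i < 4" for i
    using that by (simp_all add: phi1_def mat_of_rows_list_def len)
  have c: "phi1 ps \<in> carrier_mat 1 4"
    by (simp add: phi1_def mat_of_rows_list_def len)
  have "B * A = 0\<^sub>m 4 2"
  proof (rule eq_matI)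
    fix i j assume "i < dim_row (0\<^sub>m 4 2 :: 'k biring mat)" "j < dim_col (0\<^sub>m 4 2 :: 'k biring mat)"
    then show "(B * A) $$ (i, j) = 0\<^sub>m 4 2 $$ (i, j)"
      using A B BA[of i j] by (simp add: scalar_prod_def atLeast0LessThan)
  qed (use A B in auto)
  moreover have "phi1 ps * B = 0\<^sub>m 1 5"
  proof (rule eq_matI)
    fix i j assume "i < dim_row (0\<^sub>m 1 5 :: 'k biring mat)" "j < dim_col (0\<^sub>m 1 5 :: 'k biring mat)"
    then show "(phi1 ps * B) $$ (i, j) = 0\<^sub>m 1 5 $$ (i, j)"
      using c B psB[of j] phi1(2) by (simp add: scalar_prod_def atLeast0LessThan)
  qed (use c B in auto)
  moreover have "bigraded_map F3 F2 A"
    by (rule bigraded_mapI) (simp_all add: lens A degA)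
  moreover have "bigraded_map F2 F1 B"
    by (rule bigraded_mapI) (simp_all add: lens B degB)
  moreover have "bigraded_map F1 [(0,0)] (phi1 ps)"
    by (rule bigraded_mapI) (use c ps in \<open>simp_all add: lens F1 phi1(2)\<close>)
  moreover have "(phi1 ps *\<^sub>v x) $ 0 \<in> gen_ideal W" if "x \<in> carrier_vec 4" for x
    using phi1_in_gen_ideal[OF basis] that len by simp
  ultimately show ?thesis
    by (simp add: bigraded_complex_def lens)
qed

lemma all_less_numerals:
  "(\<forall>i<2::nat. P i) \<longleftrightarrow> P 0 \<and> P 1"
  "(\<forall>i<4::nat. P i) \<longleftrightarrow> P 0 \<and> P 1 \<and> P 2 \<and> P 3"
  "(\<forall>i<5::nat. P i) \<longleftrightarrow> P 0 \<and> P 1 \<and> P 2 \<and> P 3 \<and> P 4"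
  by (auto simp: less_Suc_eq numeral_eq_Suc)

lemma sum_lessThan_45:
  "(\<Sum>i<4. f i) = f 0 + f 1 + f 2 + f (3::nat)"
  "(\<Sum>i<5. f i) = f 0 + f 1 + f 2 + f 3 + f (4::nat)"
  by (simp_all add: lessThan_Suc numeral_eq_Suc add.commute add.left_commute)

text \<open>The entries \<open>\<gamma>, \<delta>\<close> of \<open>phi3_1\<close> cancel the
  \<open>v\<close>-terms in the first row of the product with \<open>phi2_1\<close>. Up to the
  factors \<open>x y\<close> and \<open>- y^2\<close>, the first row leaves \<open>u r1\<close> and
  the second \<open>u r2 + v r3\<close>; the other rows cancel identically.\<close>

lemma nf1_complex:
  fixes a b \<alpha> \<beta> :: "nat \<Rightarrow> 'k::field"
  assumes xy: "x \<in> R_deg (1, 0)" "y \<in> R_deg (1, 0)" and basis: "list_basis W (nf1 x y a b)"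
    and q: "quad_form a b = lin_uv \<alpha> \<beta> 1 * lin_uv \<alpha> \<beta> 2"
  shows "bigraded_complex F3 F2 F1 (gen_ideal W) (phi3_1 x y a b \<alpha> \<beta>) (phi2_1 x y a b \<alpha> \<beta>) (phi1 (nf1 x y a b))"
proof (rule complexI[OF basis])
  note deg_simps = Let_def mat_of_rows_list_def F1_def F2_def F3_def power2_eq_square mult.assoc
    R_deg_mult_10 R_deg_mult_01
  show "length (nf1 x y a b) = 4" by (simp add: nf1_def Let_def)
  show "phi3_1 x y a b \<alpha> \<beta> \<in> carrier_mat 5 2" "phi2_1 x y a b \<alpha> \<beta> \<in> carrier_mat 4 5"
    by (simp_all add: phi3_1_def phi2_1_def Let_def mat_of_rows_list_def numeral_eq_Suc)
  have "\<forall>i<4. nf1 x y a b ! i \<in> R_deg (2, 1)"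
    unfolding all_less_numerals using xy by (simp add: nf1_def deg_simps)
  then show "nf1 x y a b ! i \<in> R_deg (2, 1)" if "i < 4" for i using that by blast
  have "\<forall>i<5. \<forall>j<2. phi3_1 x y a b \<alpha> \<beta> $$ (i, j) \<in> R_deg (fst (F3 ! j) - fst (F2 ! i), snd (F3 ! j) - snd (F2 ! i))"
    unfolding all_less_numerals using xy by (simp add: phi3_1_def deg_simps)
  then show "phi3_1 x y a b \<alpha> \<beta> $$ (i, j) \<in> R_deg (fst (F3 ! j) - fst (F2 ! i), snd (F3 ! j) - snd (F2 ! i))"
    if "i < 5" "j < 2" for i j
    using that by blast
  have "\<forall>i<4. \<forall>j<5. phi2_1 x y a b \<alpha> \<beta> $$ (i, j) \<in> R_deg (fst (F2 ! j) - fst (F1 ! i), snd (F2 ! j) - snd (F1 ! i))"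
    unfolding all_less_numerals using xy by (simp add: phi2_1_def deg_simps)
  then show "phi2_1 x y a b \<alpha> \<beta> $$ (i, j) \<in> R_deg (fst (F2 ! j) - fst (F1 ! i), snd (F2 ! j) - snd (F1 ! i))"
    if "i < 4" "j < 5" for i j
    using that by blast
  define M where "M i j = (\<Sum>k<5. phi2_1 x y a b \<alpha> \<beta> $$ (i, k) * phi3_1 x y a b \<alpha> \<beta> $$ (k, j))" for i j
  \<comment> \<open>These are the coefficients of \<open>L\<^sub>1 L\<^sub>2 - q\<close> at
    \<open>u^2\<close>, \<open>u v\<close> and \<open>v^2\<close>. Keeping them as names makes the
    formulas for \<open>M\<close> plain polynomial identities.\<close>
  define r1 r2 r3 where
    "r1 = const (\<alpha> 1) * const (\<alpha> 2) - (const (a 1) * const (a 4) - const (a 2) * const (a 3))" and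
    "r2 = const (\<alpha> 1) * const (\<beta> 2) + const (\<beta> 1) * const (\<alpha> 2)
      - (const (a 1) * const (b 4) + const (b 1) * const (a 4)
        - const (a 2) * const (b 3) - const (b 2) * const (a 3))" and
    "r3 = const (\<beta> 1) * const (\<beta> 2) - (const (b 1) * const (b 4) - const (b 2) * const (b 3))"
  have r: "r1 = 0" "r2 = 0" "r3 = 0"
    by (simp_all only: r1_def r2_def r3_def quad_form_coeffs[OF q] diff_self)
  note expand = sum_lessThan_45 phi2_1_def mat_of_rows_list_def Let_def lin_uv_def const_mult const_add const_diff
    const_uminus power2_eq_square algebra_simps
  have M: "M 0 0 = (x * y) * (var Vu * r1)" "M 1 0 = (x * y) * (var Vu * r2 + var Vv * r3)"
    "M 0 1 = - (y * y) * (var Vu * r1)" "M 1 1 = - (y * y) * (var Vu * r2 + var Vv * r3)"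
    "M 2 0 = 0" "M 2 1 = 0" "M 3 0 = 0" "M 3 1 = 0"
    unfolding M_def r1_def r2_def r3_def by (simp_all add: phi3_1_def expand)
  have "\<forall>i<4. \<forall>j<2. M i j = 0"
    unfolding all_less_numerals by (simp only: M r mult_zero_right add_0 simp_thms)
  then show "(\<Sum>k<5. phi2_1 x y a b \<alpha> \<beta> $$ (i, k) * phi3_1 x y a b \<alpha> \<beta> $$ (k, j)) = 0"
    if "i < 4" "j < 2" for i j
    using that unfolding M_def by blast
  define N where "N j = (\<Sum>k<4. nf1 x y a b ! k * phi2_1 x y a b \<alpha> \<beta> $$ (k, j))" for j
  define s where "s = lin_uv \<alpha> \<beta> 1 * lin_uv \<alpha> \<beta> 2 - quad_form a b"
  have s: "s = 0" using q by (simp add: s_def)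
  \<comment> \<open>Only column \<open>1\<close> needs the factorisation: its upper entries
    contribute \<open>L\<^sub>1 L\<^sub>2\<close> and its lower ones \<open>- q\<close>.\<close>
  have N: "N 0 = 0" "N 1 = (x * x * y) * s" "N 2 = 0" "N 3 = 0" "N 4 = 0"
    unfolding N_def s_def quad_form_def by (simp_all add: nf1_def expand)
  have "\<forall>j<5. N j = 0"
    unfolding all_less_numerals by (simp only: N s mult_zero_right simp_thms)
  then show "(\<Sum>k<4. nf1 x y a b ! k * phi2_1 x y a b \<alpha> \<beta> $$ (k, j)) = 0" if "j < 5" for j
    using that unfolding N_def by blast
qed

text \<open>As in the square case, but the first column of the product of \<open>phi2_2\<close> and
  \<open>phi3_2\<close> carries the factor \<open>x^2\<close>, and two columns of
  \<open>phi2_2\<close> now pair with the basis to multiples of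
  \<open>L\<^sub>1 L\<^sub>2 - q\<close>.\<close>

lemma nf2_complex:
  fixes a b \<alpha> \<beta> :: "nat \<Rightarrow> 'k::field"
  assumes xy: "x \<in> R_deg (1, 0)" "y \<in> R_deg (1, 0)" and basis: "list_basis W (nf2 x y a b)"
    and q: "quad_form a b = lin_uv \<alpha> \<beta> 1 * lin_uv \<alpha> \<beta> 2"
  shows "bigraded_complex F3 F2 F1 (gen_ideal W) (phi3_2 x y a b \<alpha> \<beta>) (phi2_2 x y a b \<alpha> \<beta>) (phi1 (nf2 x y a b))"
proof (rule complexI[OF basis])
  note deg_simps = Let_def mat_of_rows_list_def F1_def F2_def F3_def power2_eq_square mult.assoc
    R_deg_mult_10 R_deg_mult_01
  show "length (nf2 x y a b) = 4" by (simp add: nf2_def Let_def)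
  show "phi3_2 x y a b \<alpha> \<beta> \<in> carrier_mat 5 2" "phi2_2 x y a b \<alpha> \<beta> \<in> carrier_mat 4 5"
    by (simp_all add: phi3_2_def phi2_2_def Let_def mat_of_rows_list_def numeral_eq_Suc)
  have "\<forall>i<4. nf2 x y a b ! i \<in> R_deg (2, 1)"
    unfolding all_less_numerals using xy by (simp add: nf2_def deg_simps)
  then show "nf2 x y a b ! i \<in> R_deg (2, 1)" if "i < 4" for i using that by blast
  have "\<forall>i<5. \<forall>j<2. phi3_2 x y a b \<alpha> \<beta> $$ (i, j) \<in> R_deg (fst (F3 ! j) - fst (F2 ! i), snd (F3 ! j) - snd (F2 ! i))"
    unfolding all_less_numerals using xy by (simp add: phi3_2_def deg_simps)
  then show "phi3_2 x y a b \<alpha> \<beta> $$ (i, j) \<in> R_deg (fst (F3 ! j) - fst (F2 ! i), snd (F3 ! j) - snd (F2 ! i))"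
    if "i < 5" "j < 2" for i j
    using that by blast
  have "\<forall>i<4. \<forall>j<5. phi2_2 x y a b \<alpha> \<beta> $$ (i, j) \<in> R_deg (fst (F2 ! j) - fst (F1 ! i), snd (F2 ! j) - snd (F1 ! i))"
    unfolding all_less_numerals using xy by (simp add: phi2_2_def deg_simps)
  then show "phi2_2 x y a b \<alpha> \<beta> $$ (i, j) \<in> R_deg (fst (F2 ! j) - fst (F1 ! i), snd (F2 ! j) - snd (F1 ! i))"
    if "i < 4" "j < 5" for i j
    using that by blast
  define M where "M i j = (\<Sum>k<5. phi2_2 x y a b \<alpha> \<beta> $$ (i, k) * phi3_2 x y a b \<alpha> \<beta> $$ (k, j))" for i j
  define r1 r2 r3 where
    "r1 = const (\<alpha> 1) * const (\<alpha> 2) - (const (a 1) * const (a 4) - const (a 2) * const (a 3))" and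
    "r2 = const (\<alpha> 1) * const (\<beta> 2) + const (\<beta> 1) * const (\<alpha> 2)
      - (const (a 1) * const (b 4) + const (b 1) * const (a 4)
        - const (a 2) * const (b 3) - const (b 2) * const (a 3))" and
    "r3 = const (\<beta> 1) * const (\<beta> 2) - (const (b 1) * const (b 4) - const (b 2) * const (b 3))"
  have r: "r1 = 0" "r2 = 0" "r3 = 0"
    by (simp_all only: r1_def r2_def r3_def quad_form_coeffs[OF q] diff_self)
  note expand = sum_lessThan_45 phi2_2_def mat_of_rows_list_def Let_def lin_uv_def const_mult const_add const_diff
    const_uminus power2_eq_square algebra_simps
  have M: "M 0 0 = (x * x) * (var Vu * r1)" "M 1 0 = (x * x) * (var Vu * r2 + var Vv * r3)"
    "M 0 1 = - (y * y) * (var Vu * r1)" "M 1 1 = - (y * y) * (var Vu * r2 + var Vv * r3)"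
    "M 2 0 = 0" "M 2 1 = 0" "M 3 0 = 0" "M 3 1 = 0"
    unfolding M_def r1_def r2_def r3_def by (simp_all add: phi3_2_def expand)
  have "\<forall>i<4. \<forall>j<2. M i j = 0"
    unfolding all_less_numerals by (simp only: M r mult_zero_right add_0 simp_thms)
  then show "(\<Sum>k<5. phi2_2 x y a b \<alpha> \<beta> $$ (i, k) * phi3_2 x y a b \<alpha> \<beta> $$ (k, j)) = 0"
    if "i < 4" "j < 2" for i j
    using that unfolding M_def by blast
  define N where "N j = (\<Sum>k<4. nf2 x y a b ! k * phi2_2 x y a b \<alpha> \<beta> $$ (k, j))" for j
  define s where "s = lin_uv \<alpha> \<beta> 1 * lin_uv \<alpha> \<beta> 2 - quad_form a b"
  have s: "s = 0" using q by (simp add: s_def)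
  have N: "N 0 = 0" "N 1 = - (x * y * y) * s" "N 2 = (x * x * y) * s" "N 3 = 0" "N 4 = 0"
    unfolding N_def s_def quad_form_def by (simp_all add: nf2_def expand)
  have "\<forall>j<5. N j = 0"
    unfolding all_less_numerals by (simp only: N s mult_zero_right simp_thms)
  then show "(\<Sum>k<4. nf2 x y a b ! k * phi2_2 x y a b \<alpha> \<beta> $$ (k, j)) = 0" if "j < 5" for j
    using that unfolding N_def by blast
qed

section \<open>Reduction to normal form\<close>

text \<open>A maximal independent subset of \<open>W\<close> containing \<open>v, w\<close> has four
  elements by dimension, which leaves exactly two more.\<close>

lemma basis_extending:
  fixes v w :: "'k::field biring"
  assumes W: "kvs.subspace W" and dim: "kvs.dim W = 4" and vw: "v \<in> W" "w \<in> W" "v \<noteq> w" "kvs.independent {v, w}"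
  obtains p q where "list_basis W [v, w, p, q]"
proof -
  obtain B where B: "{v, w} \<subseteq> B" "B \<subseteq> W" "kvs.independent B" "W \<subseteq> kvs.span B"
    using kvs.maximal_independent_subset_extend[of "{v, w}" W] vw by blast
  have "card B = 4" using kvs.basis_card_eq_dim[OF B(2,4,3)] dim by simp
  moreover have "finite B" using \<open>card B = 4\<close> card.infinite by fastforce
  ultimately have "card (B - {v, w}) = 2"
    using B(1) vw(3) by (simp add: card_Diff_subset)
  then obtain p q where "B - {v, w} = {p, q}" "p \<noteq> q" by (auto simp: card_2_iff)
  then have "set [v, w, p, q] = B" using B(1) by auto
  moreover have "kvs.span B = W"
    using B(2,4) W kvs.span_subspace by blast
  ultimately have "list_basis W [v, w, p, q]"
    using list_basis_iff_span[of W "[v, w, p, q]"] dim by simp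
  then show thesis ..
qed

lemma pencil_basis_exists:
  fixes fs :: "'k::field biring list"
  assumes W: "kvs.subspace W" "kvs.dim W = 4" "W \<subseteq> R_deg (2, 1)" and fs: "kvs.span (set fs) = W"
    and len: "length fs = 4" and g: "is_syzygy fs (0,1) g"
  shows "\<exists>p p2 p3. pencil_basis W p p2 p3"
proof -
  have basis: "list_basis W fs"
    using list_basis_iff_span[of W fs] W(2) len fs by simp
  have "\<exists>\<alpha> \<beta>. g $ i = const \<alpha> * var Vu + const \<beta> * var Vv" if "i < length fs" for i
    using g that unfolding is_syzygy_def by (metis R_deg_01E)
  then obtain \<alpha> \<beta> where \<alpha>\<beta>: "\<And>i. i < length fs \<Longrightarrow> g $ i = const (\<alpha> i) * var Vu + const (\<beta> i) * var Vv"
    by metis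
  define P Q where "P = (\<Sum>i<length fs. const (\<alpha> i) * fs ! i)" and "Q = (\<Sum>i<length fs. const (\<beta> i) * fs ! i)"
  have "var Vu * P + var Vv * Q = (\<Sum>i<length fs. g $ i * fs ! i)"
    by (simp add: P_def Q_def \<alpha>\<beta> sum_distrib_left sum.distrib distrib_right distrib_left mult_ac)
  also have "\<dots> = 0" using g by (simp add: is_syzygy_def)
  finally obtain p where p: "P = p * var Vv" "Q = - p * var Vu" by (rule syzygy_uvE)
  \<comment> \<open>As constant combinations of \<open>fs\<close> these lie in \<open>W\<close>,
    which will place \<open>p v\<close> and \<open>p u\<close> there.\<close>
  have PQ: "P \<in> W" "Q \<in> W"
    unfolding P_def Q_def fs[symmetric] by (rule const_comb_in_span)+
  \<comment> \<open>Otherwise \<open>P\<close> and \<open>Q\<close> vanish, and independence of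
    \<open>fs\<close> kills all coefficients of the nonzero syzygy \<open>g\<close>.\<close>
  have "p \<noteq> 0"
  proof
    assume "p = 0"
    with p have "P = 0" "Q = 0" by simp_all
    then have "\<alpha> i = 0" "\<beta> i = 0" if "i < length fs" for i
      using list_basis_unique_coeffs[OF basis _ that] unfolding P_def Q_def by blast+
    then have "g = 0\<^sub>v (length fs)"
      using g \<alpha>\<beta> by (intro eq_vecI) (auto simp: is_syzygy_def)
    then show False using g by (simp add: is_syzygy_def)
  qed
  \<comment> \<open>Each monomial of \<open>p\<close> becomes a monomial of \<open>P\<close> after
    multiplication by \<open>v\<close>, and \<open>P\<close> has bidegree
    \<open>(2, 1)\<close>.\<close>
  have "p \<in> R_deg (2, 0)"
    unfolding R_deg_def
  proof (intro CollectI ballI)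
    fix m assume "m \<in> Poly_Mapping.keys p"
    then have "Poly_Mapping.lookup (var Vv * p) (Poly_Mapping.single Vv 1 + m) \<noteq> 0"
      by (simp only: lookup_var_mult_add in_keys_iff not_False_eq_True)
    then have "Poly_Mapping.single Vv 1 + m \<in> Poly_Mapping.keys P"
      by (simp only: p(1) in_keys_iff mult.commute not_False_eq_True)
    with R_degD[of P 2 1] PQ(1) W(3)
    show "int (Poly_Mapping.lookup m Vs + Poly_Mapping.lookup m Vt) = fst (2, 0) \<and>
        int (Poly_Mapping.lookup m Vu + Poly_Mapping.lookup m Vv) = snd (2, 0)"
      by (fastforce simp: lookup_add lookup_single)
  qed
  have "p * var Vu = - Q" using p(2) by simp
  then have pu: "p * var Vu \<in> W"
    using PQ(2) kvs.subspace_neg[OF W(1)] by simp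
  obtain p2 p3 where b: "list_basis W [p * var Vu, p * var Vv, p2, p3]"
    using basis_extending[OF W(1,2) pu _ _ _] PQ(1) p(1) independent_pu_pv[OF \<open>p \<in> _\<close> \<open>p \<noteq> 0\<close>] by metis
  then have "gen_ideal W = gen_ideal {p * var Vu, p * var Vv, p2, p3}"
    using gen_ideal_span[of "{p * var Vu, p * var Vv, p2, p3}"] by (simp add: list_basis_def)
  with b \<open>p \<in> _\<close> show ?thesis
    unfolding pencil_basis_def by blast
qed

text \<open>The change of basis is triangular with unit diagonal, so the span is unchanged. It
  serves to clear the multiples of \<open>p u\<close> and \<open>p v\<close> from the other two
  basis elements.\<close>

lemma list_basis_reduce:
  fixes v w :: "'k::field biring"
  assumes dim: "kvs.dim W = 4" and basis: "list_basis W [v, w, p2, p3]"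
    and p: "p2 = const a * v + const b * w + q2" "p3 = const c * v + const d * w + q3"
  shows "list_basis W [v, w, q2, q3]"
proof -
  have "kvs.span {v, w, q2, q3} = kvs.span {v, w, p2, p3}"
  proof (rule kvs.span_eq[THEN iffD2], intro conjI)
    have in_span: "const a * v + const b * w \<in> kvs.span {v, w, r, s}" for a b r s
      unfolding kscale_def[symmetric] by (intro kvs.span_add kvs.span_scale kvs.span_base) auto
    have "q2 = p2 - (const a * v + const b * w)" "q3 = p3 - (const c * v + const d * w)"
      using p by simp_all
    then have "q2 \<in> kvs.span {v, w, p2, p3}" "q3 \<in> kvs.span {v, w, p2, p3}"
      by (auto intro!: kvs.span_diff in_span intro: kvs.span_base)
    then show "{v, w, q2, q3} \<subseteq> kvs.span {v, w, p2, p3}"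
      by (auto intro: kvs.span_base)
    have "p2 \<in> kvs.span {v, w, q2, q3}" "p3 \<in> kvs.span {v, w, q2, q3}"
      unfolding p by (auto intro!: kvs.span_add[OF in_span] intro: kvs.span_base)
    then show "{v, w, p2, p3} \<subseteq> kvs.span {v, w, q2, q3}"
      by (auto intro: kvs.span_base)
  qed
  with basis list_basis_iff_span[of W "[v, w, q2, q3]"] dim show ?thesis
    by (simp add: list_basis_def)
qed

section \<open>The two normal forms\<close>

text \<open>With \<open>l\<close> as first coordinate, the \<open>x^2\<close>-part of a form of
  bidegree \<open>(2, 1)\<close> is a constant combination of \<open>p u\<close> and
  \<open>p v\<close> and can be subtracted, leaving the parts in \<open>x y\<close> and
  \<open>y^2\<close>.\<close>

lemma pencil_basis_nf1:
  fixes W :: "'k::field biring set"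
  assumes W: "kvs.dim W = 4" "W \<subseteq> R_deg (2, 1)" and pb: "pencil_basis W p p2 p3"
    and l: "l \<in> R_deg (1, 0)" "p = l^2"
  shows "\<exists>x y a b. linear_change_st x y \<and> p = x^2 \<and> list_basis W (nf1 x y a b)"
proof -
  have basis: "list_basis W [l^2 * var Vu, l^2 * var Vv, p2, p3]"
    using pb l(2) by (simp add: pencil_basis_def)
  have "l \<noteq> 0"
  proof
    assume "l = 0"
    with basis show False by (simp add: list_basis_def)
  qed
  then obtain y where xy: "linear_change_st l y" using linear_change_complement l(1) by blast
  have "p2 \<in> R_deg (2, 1)" "p3 \<in> R_deg (2, 1)"
    using basis W(2) by (auto simp: list_basis_def intro: kvs.span_base)
  then obtain a1 b1 a2 b2 a3 b3 c1 d1 c2 d2 c3 d3 where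
    p2: "p2 = l^2 * (const a1 * var Vu + const b1 * var Vv) + l * y * (const a2 * var Vu + const b2 * var Vv)
       + y^2 * (const a3 * var Vu + const b3 * var Vv)" and
    p3: "p3 = l^2 * (const c1 * var Vu + const d1 * var Vv) + l * y * (const c2 * var Vu + const d2 * var Vv)
       + y^2 * (const c3 * var Vu + const d3 * var Vv)"
    by (metis R_deg_21_linear_changeE[OF xy])
  \<comment> \<open>\<open>l\<^sub>1, l\<^sub>2\<close> are the surviving coefficients of
    \<open>p2\<close>, and \<open>l\<^sub>3, l\<^sub>4\<close> those of \<open>p3\<close>.\<close>
  let ?a = "(\<lambda>_. 0)(1 := a2, 2 := a3, 3 := c2, 4 := c3)"
  let ?b = "(\<lambda>_. 0)(1 := b2, 2 := b3, 3 := d2, 4 := d3)"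
  have "list_basis W (nf1 l y ?a ?b)"
    unfolding nf1_def Let_def
    by (rule list_basis_reduce[OF W(1) basis, of a1 b1 _ c1 d1])
      (simp_all add: p2 p3 lin_uv_def algebra_simps)
  with xy l(2) show ?thesis by blast
qed

text \<open>Now \<open>p = x y\<close>, so the middle part in \<open>x y\<close> is the one that
  \<open>p u\<close> and \<open>p v\<close> remove.\<close>

lemma pencil_basis_nf2:
  fixes W :: "'k::field biring set"
  assumes W: "kvs.dim W = 4" "W \<subseteq> R_deg (2, 1)" and pb: "pencil_basis W p p2 p3"
    and xy: "linear_change_st x y" "p = x * y"
  shows "\<exists>x y a b. linear_change_st x y \<and> p = x * y \<and> list_basis W (nf2 x y a b)"
proof -
  have basis: "list_basis W [x * y * var Vu, x * y * var Vv, p2, p3]"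
    using pb xy(2) by (simp add: pencil_basis_def)
  have "p2 \<in> R_deg (2, 1)" "p3 \<in> R_deg (2, 1)"
    using basis W(2) by (auto simp: list_basis_def intro: kvs.span_base)
  then obtain a1 b1 a2 b2 a3 b3 c1 d1 c2 d2 c3 d3 where
    p2: "p2 = x^2 * (const a1 * var Vu + const b1 * var Vv) + x * y * (const a2 * var Vu + const b2 * var Vv)
       + y^2 * (const a3 * var Vu + const b3 * var Vv)" and
    p3: "p3 = x^2 * (const c1 * var Vu + const d1 * var Vv) + x * y * (const c2 * var Vu + const d2 * var Vv)
       + y^2 * (const c3 * var Vu + const d3 * var Vv)"
    by (metis R_deg_21_linear_changeE[OF xy(1)])
  let ?a = "(\<lambda>_. 0)(1 := a1, 2 := a3, 3 := c1, 4 := c3)"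
  let ?b = "(\<lambda>_. 0)(1 := b1, 2 := b3, 3 := d1, 4 := d3)"
  have "list_basis W (nf2 x y ?a ?b)"
    unfolding nf2_def Let_def
    by (rule list_basis_reduce[OF W(1) basis, of a2 b2 _ c2 d2])
      (simp_all add: p2 p3 lin_uv_def algebra_simps)
  with xy show ?thesis by blast
qed

theorem proposition3p2:
  fixes U :: "'k::alg_closed_field biring set" and f0 f1 f2 f3 :: "'k biring"
  assumes "U \<subseteq> R_deg (2,1)"
    and "kvs.subspace U" and "kvs.dim U = 4"
    and "U = kvs.span {f0, f1, f2, f3}"
    and "basepoint_free U"
    and "unique_syzygy [f0, f1, f2, f3] (0,1)"
  shows
    "(\<exists>p p2 p3. pencil_basis U p p2 p3) \<and>
     (\<forall>p p2 p3. pencil_basis U p p2 p3 \<longrightarrow>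
        (square_of_linear p \<or> product_of_independent_linear p) \<and>
        (square_of_linear p \<longrightarrow>
           (\<exists>x y a b. linear_change_st x y \<and> p = x^2 \<and> list_basis U (nf1 x y a b))) \<and>
        (product_of_independent_linear p \<longrightarrow>
           (\<exists>x y a b. linear_change_st x y \<and> p = x * y \<and> list_basis U (nf2 x y a b)))) \<and>
     (\<forall>x y a b. linear_change_st x y \<and> list_basis U (nf1 x y a b) \<longrightarrow>
        quad_form a b \<noteq> 0 \<and>
        (\<exists>\<alpha> \<beta>. quad_form a b = lin_uv \<alpha> \<beta> 1 * lin_uv \<alpha> \<beta> 2) \<and>
        (\<forall>\<alpha> \<beta>. quad_form a b = lin_uv \<alpha> \<beta> 1 * lin_uv \<alpha> \<beta> 2 \<longrightarrow>
           bigraded_complex F3 F2 F1 (gen_ideal U)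
             (phi3_1 x y a b \<alpha> \<beta>) (phi2_1 x y a b \<alpha> \<beta>) (phi1 (nf1 x y a b)))) \<and>
     (\<forall>x y a b. linear_change_st x y \<and> list_basis U (nf2 x y a b) \<longrightarrow>
        quad_form a b \<noteq> 0 \<and>
        (\<exists>\<alpha> \<beta>. quad_form a b = lin_uv \<alpha> \<beta> 1 * lin_uv \<alpha> \<beta> 2) \<and>
        (\<forall>\<alpha> \<beta>. quad_form a b = lin_uv \<alpha> \<beta> 1 * lin_uv \<alpha> \<beta> 2 \<longrightarrow>
           bigraded_complex F3 F2 F1 (gen_ideal U)
             (phi3_2 x y a b \<alpha> \<beta>) (phi2_2 x y a b \<alpha> \<beta>) (phi1 (nf2 x y a b))))"
proof (intro conjI allI impI; (elim conjE)?)
  have fs: "kvs.span (set [f0, f1, f2, f3]) = U" using assms(4) by simp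
  note uniq = \<open>unique_syzygy [f0, f1, f2, f3] (0,1)\<close>
  then obtain g where "is_syzygy [f0, f1, f2, f3] (0,1) g"
    by (auto simp: unique_syzygy_def)
  then show "\<exists>p p2 p3. pencil_basis U p p2 p3"
    using pencil_basis_exists[OF assms(2,3,1) fs] by simp
  show "quad_form a b \<noteq> 0" if "list_basis U (nf1 x y a b)" for x y a b
    using quad_form_nonzero[OF uniq fs, of "x^2" "x * y" a b "y^2"] that by (simp add: nf1_def Let_def)
  show "quad_form a b \<noteq> 0" if "list_basis U (nf2 x y a b)" for x y a b
    using quad_form_nonzero[OF uniq fs, of "x * y" "x^2" a b "y^2"] that by (simp add: nf2_def Let_def)
next
  fix p p2 p3 assume pb: "pencil_basis U p p2 p3"
  then show "square_of_linear p \<or> product_of_independent_linear p"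
    by (intro R_deg_20_factor) (simp add: pencil_basis_def)
  show "\<exists>x y a b. linear_change_st x y \<and> p = x^2 \<and> list_basis U (nf1 x y a b)"
    if "square_of_linear p"
    using that pencil_basis_nf1[OF assms(3,1) pb] by (auto simp: square_of_linear_def)
  show "\<exists>x y a b. linear_change_st x y \<and> p = x * y \<and> list_basis U (nf2 x y a b)"
    if "product_of_independent_linear p"
    using that pencil_basis_nf2[OF assms(3,1) pb] linear_change_independent
    unfolding product_of_independent_linear_def by blast
\<comment> \<open>What remains, for both normal forms, is the existence of a factorisation of
  \<open>q\<close> and the complex belonging to each factorisation.\<close>
qed (blast intro: quad_form_factor nf1_complex nf2_complex linear_change_R_deg)+

end
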